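(* Let $H\in\mathbb{C}(t)[q,p]$ and consider the polynomial Hamiltonian system $\frac{dq}{dt}=\frac{\partial H}{\partial p}$, $\frac{dp}{dt}=-\frac{\partial H}{\partial q}$. Assume: (A1) $\deg(H)=10$ with respect to $q,p$; (A2) the system becomes again a polynomial Hamiltonian system in each of the coordinates $$\begin{aligned} r_0&: x_0=1/q,\ y_0=-(qp+\alpha_0)q,\\ r_1&: x_1=-(pq-\alpha_1)p,\ y_1=1/p,\\ r_2&: x_2=-(pq-(\alpha_1+\alpha_2))p,\ y_2=1/p,\\ r_3&: x_3=-(pq-(\alpha_1+\alpha_2+\alpha_3))p,\ y_3=1/p,\\ r_4&: x_4=-(p(q-1)-\alpha_4)p,\ y_4=1/p,\\ r_5&: x_5=-(p(q-1)-(\alpha_4+\alpha_5))p,\ y_5=1/p,\\ r_6&: x_6=-(p(q-1)-(\alpha_4+\alpha_5+\alpha_6))p,\ y_6=1/p; \end{aligned}$$ (A3) in addition to (A2), the Hamiltonian system in the coordinates $(x_0,y_0)$ of $r_0$ becomes again a polynomial Hamiltonian system in the coordinates $r_7: x_7=-(x_0y_0-\alpha_7)y_0,\ y_7=1/y_0$. Then such a system coincides with the system $\frac{dq}{dt}=\frac{\partial I}{\partial p}$, $\frac{dp}{dt}=-\frac{\partial I}{\partial q}$, where $I$ is the polynomial $$\begin{aligned} I={}&q^3(q-1)^3p^4+q^2(q-1)^2(2\kappa q+\beta_1)p^3+q(q-1)\{\delta q^2+(\gamma_2-\beta_2-\delta)q+\beta_2\}p^2\\ &+\{2\kappa\varepsilon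 q^3+f_2q^2-(2\kappa\varepsilon+f_2+\beta_3+\gamma_3)q+\beta_3\}p+\varepsilon^2q^2+\varepsilon b\,q \end{aligned}$$ with the constants defined in the context. Here the constant parameters $\alpha_i$ satisfy the relation $4\alpha_0+3\alpha_1+2\alpha_2+\alpha_3+3\alpha_4+2\alpha_5+\alpha_6+2\alpha_7=0$.
   Context: A Hamiltonian system in $(q,p)$ "becomes again a polynomial Hamiltonian system" in coordinates $(x,y)$, where $(q,p)\mapsto(x,y)$ is a birational symplectic change of variables ($dx\wedge dy=dq\wedge dp$), if in the new variables it takes the form $\frac{dx}{dt}=\frac{\partial K}{\partial y}$, $\frac{dy}{dt}=-\frac{\partial K}{\partial x}$ for some $K\in\mathbb{C}(t)[x,y]$. The $\alpha_0,\dots,\alpha_7$ are constant complex parameters. Constants in $I$: $\kappa=2\alpha_0+\alpha_7$, $\varepsilon=\alpha_0(\alpha_0+\alpha_7)$, $\delta=\kappa^2+2\varepsilon=6\alpha_0^2+6\alpha_0\alpha_7+\alpha_7^2$; $\beta_1,\beta_2,\beta_3$ are the elementary symmetric functions (of degree 1, 2, 3) of the three numbers $\alpha_1,\ \alpha_1+\alpha_2,\ \alpha_1+\alpha_2+\alpha_3$ (so $\beta_1=3\alpha_1+2\alpha_2+\alpha_3$); $\gamma_1,\gamma_2,\gamma_3$ are the elementary symmetric functions of $\alpha_4,\ \alpha_4+\alpha_5,\ \alpha_4+\alpha_5+\alpha_6$; $$f_2=\kappa(\gamma_2-\beta_2)-\kappa^3-2\kappa\varepsilon-\kappa^2\beta_1+\varepsilon\beta_1,\qquad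 b=\gamma_2-\beta_2-\kappa^2-\varepsilon-\kappa\beta_1 .$$
   Formalization: "Coincides" is up to a nonzero factor in C(t), the coefficient of q^6p^4 in H (H=2I also satisfies (A1)-(A3)); at least five of r_1,...,r_6 are assumed distinct (for all α_i=0, H=q^2(q-1)^2(q^2+1)p^4 is a counterexample). *)

theory Defs
  imports "HOL-Computational_Algebra.Computational_Algebra"
begin

type_synonym ct = "complex poly fract"

text \<open>
  Polynomials over \<open>\<complex>(t)\<close> in the canonical variables \<open>(q,p)\<close> have type
  \<^typ>\<open>ct poly poly\<close>: the outer variable is \<open>p\<close>, the inner one is \<open>q\<close>, so
  \<^term>\<open>coeff (coeff H j) i\<close> is the coefficient of \<open>q\<^sup>i p\<^sup>j\<close>. The field
  \<open>\<complex>(t)(q,p)\<close> is \<^typ>\<open>ct poly poly fract\<close>.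
\<close>

definition var_q :: "ct poly poly" where "var_q = [:[:0, 1:]:]"

definition var_p :: "ct poly poly" where "var_p = [:0, 1:]"

definition const :: "complex \<Rightarrow> ct poly poly" where "const c = [:[:to_fract [:c:]:]:]"

definition total_degree :: "ct poly poly \<Rightarrow> nat" where
  "total_degree H = Max (insert 0 {i + j |i j. coeff (coeff H j) i \<noteq> 0})"


subsection \<open>Derivations\<close>

text \<open>The extension of a derivation of an integral domain to its fraction field by the
  quotient rule. The choice of representative is immaterial, see \<open>fract_deriv_Fract\<close>.\<close>

definition fract_deriv :: "('a::idom \<Rightarrow> 'a) \<Rightarrow> 'a fract \<Rightarrow> 'a fract" where
  "fract_deriv d z =
     (let (a, b) = (SOME (a, b). b \<noteq> 0 \<and> z = Fract a b) in Fract (d a * b - a * d b) (b\<^sup>2))"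

lemma fract_deriv_Fract:
  fixes d :: "'a::idom \<Rightarrow> 'a"
  assumes leibniz: "\<And>x y. d (x * y) = d x * y + x * d y" and "b \<noteq> 0"
  shows "fract_deriv d (Fract a b) = Fract (d a * b - a * d b) (b\<^sup>2)"
proof -
  let ?P = "\<lambda>(a', b'). b' \<noteq> 0 \<and> Fract a b = Fract a' b'"
  obtain a' b' where ab: "(SOME x. ?P x) = (a', b')"
    by fastforce
  have "?P (a', b')"
    using someI[of ?P "(a, b)"] \<open>b \<noteq> 0\<close> ab by simp
  then have b': "b' \<noteq> 0" and eq: "a * b' = a' * b"
    using \<open>b \<noteq> 0\<close> by (auto simp: eq_fract)
  have "d a * b' + a * d b' = d a' * b + a' * d b"
    using arg_cong[OF eq, of d] by (simp add: leibniz)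
  then have "(d a * b - a * d b) * b'\<^sup>2 = (d a' * b' - a' * d b') * b\<^sup>2"
    using eq by algebra
  then have "Fract (d a * b - a * d b) (b\<^sup>2) = Fract (d a' * b' - a' * d b') (b'\<^sup>2)"
    using \<open>b \<noteq> 0\<close> b' by (simp add: eq_fract)
  moreover have "fract_deriv d (Fract a b) = Fract (d a' * b' - a' * d b') (b'\<^sup>2)"
    using ab unfolding fract_deriv_def by simp
  ultimately show ?thesis by simp
qed

lemma map_poly_derivation:
  fixes d :: "'a::idom \<Rightarrow> 'a"
  assumes add: "\<And>x y. d (x + y) = d x + d y"
    and leibniz: "\<And>x y. d (x * y) = d x * y + x * d y"
  shows "map_poly d (f + g) = map_poly d f + map_poly d g"
    and "map_poly d (f * g) = map_poly d f * g + f * map_poly d g"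
proof -
  have d0: "d 0 = 0" using leibniz[of 0 0] by simp
  have sum: "d (sum h A) = (\<Sum>i\<in>A. d (h i))" for h :: "nat \<Rightarrow> 'a" and A
    by (induction A rule: infinite_finite_induct) (auto simp: d0 add)
  show "map_poly d (f + g) = map_poly d f + map_poly d g"
    by (rule poly_eqI) (simp add: coeff_map_poly d0 add)
  show "map_poly d (f * g) = map_poly d f * g + f * map_poly d g"
    by (rule poly_eqI) (simp add: coeff_map_poly coeff_mult d0 sum leibniz sum.distrib)
qed

lemma fract_derivation:
  fixes d :: "'a::idom \<Rightarrow> 'a"
  assumes add: "\<And>x y. d (x + y) = d x + d y"
    and leibniz: "\<And>x y. d (x * y) = d x * y + x * d y"
  shows "fract_deriv d (x + y) = fract_deriv d x + fract_deriv d y"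
    and "fract_deriv d (x * y) = fract_deriv d x * y + x * fract_deriv d y"
proof -
  obtain a b where x: "x = Fract a b" "b \<noteq> 0" by (cases x)
  obtain a' b' where y: "y = Fract a' b'" "b' \<noteq> 0" by (cases y)
  note F = fract_deriv_Fract[OF leibniz]
  show "fract_deriv d (x + y) = fract_deriv d x + fract_deriv d y"
    using x(2) y(2) unfolding x(1) y(1)
    by (simp add: F leibniz add eq_fract del: power_mult_distrib) algebra
  show "fract_deriv d (x * y) = fract_deriv d x * y + x * fract_deriv d y"
    using x(2) y(2) unfolding x(1) y(1)
    by (simp add: F leibniz add eq_fract del: power_mult_distrib) algebra
qed

lemma fract_deriv_to_fract:
  fixes d :: "'a::idom \<Rightarrow> 'a"
  assumes "\<And>f g. d (f * g) = d f * g + f * d g"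
  shows "fract_deriv d (to_fract f) = to_fract (d f)"
    and "f \<noteq> 0 \<Longrightarrow> fract_deriv d (1 / to_fract f) = - to_fract (d f) / (to_fract f)\<^sup>2"
proof -
  have "d 1 + 0 = d 1 + d 1" using assms[of 1 1] by simp
  then have 1: "d 1 = 0" by (simp only: add_left_cancel)
  show "fract_deriv d (to_fract f) = to_fract (d f)"
    unfolding to_fract_def by (subst fract_deriv_Fract[OF assms]) (auto simp: 1)
  assume f: "f \<noteq> 0"
  have "fract_deriv d (1 / to_fract f) = fract_deriv d (Fract 1 f)"
    by (simp add: Fract_conv_to_fract)
  also have "\<dots> = Fract (- d f) (f\<^sup>2)"
    by (simp add: fract_deriv_Fract[OF assms f] 1)
  also have "\<dots> = - to_fract (d f) / (to_fract f)\<^sup>2"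
    by (simp add: Fract_conv_to_fract power2_eq_square)
  finally show "fract_deriv d (1 / to_fract f) = - to_fract (d f) / (to_fract f)\<^sup>2" .
qed

abbreviation pd_p :: "ct poly poly \<Rightarrow> ct poly poly" where "pd_p \<equiv> pderiv"

abbreviation pd_q :: "ct poly poly \<Rightarrow> ct poly poly" where "pd_q \<equiv> map_poly pderiv"

abbreviation pd_t :: "ct poly poly \<Rightarrow> ct poly poly" where
  "pd_t \<equiv> map_poly (map_poly (fract_deriv pderiv))"

lemma pd_derivation:
  "pd_p (f * g) = pd_p f * g + f * pd_p g"
  "pd_q (f * g) = pd_q f * g + f * pd_q g"
  "pd_t (f * g) = pd_t f * g + f * pd_t g"
proof -
  show "pd_p (f * g) = pd_p f * g + f * pd_p g" by (simp add: pderiv_mult algebra_simps)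
  have p: "pderiv (a * b) = pderiv a * b + a * pderiv b" for a b :: "'a::idom poly"
    by (simp add: pderiv_mult algebra_simps)
  show "pd_q (f * g) = pd_q f * g + f * pd_q g"
    by (rule map_poly_derivation(2)) (simp_all add: pderiv_add p)
  show "pd_t (f * g) = pd_t f * g + f * pd_t g"
    by (intro map_poly_derivation fract_derivation pderiv_add p)
qed

text \<open>The derivative \<open>\<partial>z/\<partial>t + (\<partial>z/\<partial>q) (\<partial>H/\<partial>p) - (\<partial>z/\<partial>p) (\<partial>H/\<partial>q)\<close> of a rational function
  along the Hamiltonian system of \<open>H\<close>.\<close>

definition flow_deriv :: "ct poly poly \<Rightarrow> ct poly poly fract \<Rightarrow> ct poly poly fract" where
  "flow_deriv H z = fract_deriv pd_t z
     + fract_deriv pd_q z * to_fract (pd_p H) - fract_deriv pd_p z * to_fract (pd_q H)"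


subsection \<open>Polynomial Hamiltonian systems\<close>

text \<open>The pair of right-hand sides of \<open>dq/dt = \<partial>H/\<partial>p\<close>, \<open>dp/dt = - \<partial>H/\<partial>q\<close>.\<close>

definition ham_system :: "ct poly poly \<Rightarrow> ct poly poly \<times> ct poly poly" where
  "ham_system H = (pd_p H, - pd_q H)"

definition subst2 ::
  "ct poly poly \<Rightarrow> ct poly poly fract \<Rightarrow> ct poly poly fract \<Rightarrow> ct poly poly fract" where
  "subst2 K x y = poly (map_poly (\<lambda>a. poly (map_poly (\<lambda>c. to_fract [:[:c:]:]) a) x) K) y"

text \<open>In the coordinates \<open>(x,y)\<close>, given as rational functions of \<open>(q,p)\<close>, the system of \<open>H\<close> reads
  \<open>dx/dt = \<partial>K/\<partial>y\<close>, \<open>dy/dt = - \<partial>K/\<partial>x\<close>. In \<open>K\<close> the inner variable stands for \<open>x\<close> and the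
  outer one for \<open>y\<close>.\<close>

definition has_hamiltonian_in ::
  "ct poly poly \<Rightarrow> ct poly poly fract \<times> ct poly poly fract \<Rightarrow> ct poly poly \<Rightarrow> bool" where
  "has_hamiltonian_in H xy K \<longleftrightarrow> (case xy of (x, y) \<Rightarrow>
     flow_deriv H x = subst2 (pd_p K) x y \<and> flow_deriv H y = - subst2 (pd_q K) x y)"

definition poly_hamiltonian_in ::
  "ct poly poly \<Rightarrow> ct poly poly fract \<times> ct poly poly fract \<Rightarrow> bool" where
  "poly_hamiltonian_in H xy \<longleftrightarrow> (\<exists>K. has_hamiltonian_in H xy K)"


subsection \<open>The coordinate systems\<close>

text \<open>\<open>(1/q, -(qp + a)q)\<close> and \<open>(-(p(q - c) - a)p, 1/p)\<close>. These changes of variables are birational,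
  and symplectic (lemmas \<open>chart_inf_symplectic\<close> and \<open>chart_at_symplectic\<close>), for all values of
  the constants, so \<open>poly_hamiltonian_in\<close> does not ask for this again.\<close>

definition chart_inf :: "complex \<Rightarrow> ct poly poly fract \<times> ct poly poly fract" where
  "chart_inf a = (1 / to_fract var_q, - to_fract ((var_q * var_p + const a) * var_q))"

definition chart_at :: "complex \<Rightarrow> complex \<Rightarrow> ct poly poly fract \<times> ct poly poly fract" where
  "chart_at c a =
     (- to_fract ((var_p * (var_q - const c) - const a) * var_p), 1 / to_fract var_p)"

lemmas fract_deriv_pd =
  pd_derivation[THEN fract_deriv_to_fract(1)] pd_derivation[THEN fract_deriv_to_fract(2)]

lemma pd_linear:
  "pd_p (a + b) = pd_p a + pd_p b" "pd_p (a - b) = pd_p a - pd_p b" "pd_p (- b) = - pd_p b"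
  "pd_q (a + b) = pd_q a + pd_q b" "pd_q (a - b) = pd_q a - pd_q b" "pd_q (- b) = - pd_q b"
  by (auto intro!: poly_eqI simp: coeff_map_poly pderiv_add pderiv_diff pderiv_minus)

lemma pd_basic:
  "pd_q var_q = 1" "pd_p var_q = 0" "pd_q var_p = 0" "pd_p var_p = 1"
  "pd_q (const c) = 0" "pd_p (const c) = 0" "var_q \<noteq> 0" "var_p \<noteq> 0"
  by (simp_all add: var_p_def var_q_def const_def map_poly_pCons pderiv_pCons one_pCons)

lemma chart_inf_symplectic:
  "case chart_inf a of (x, y) \<Rightarrow>
     fract_deriv pd_q x * fract_deriv pd_p y - fract_deriv pd_p x * fract_deriv pd_q y = 1"
  unfolding chart_inf_def to_fract_uminus[symmetric]
  by (simp add: fract_deriv_pd pd_basic pd_derivation pd_linear del: to_fract_uminus)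
    (simp add: pd_basic power2_eq_square field_simps)

lemma chart_at_symplectic:
  "case chart_at c a of (x, y) \<Rightarrow>
     fract_deriv pd_q x * fract_deriv pd_p y - fract_deriv pd_p x * fract_deriv pd_q y = 1"
  unfolding chart_at_def to_fract_uminus[symmetric]
  by (simp add: fract_deriv_pd pd_basic pd_derivation pd_linear del: to_fract_uminus)
    (simp add: pd_basic power2_eq_square field_simps)

definition r_charts :: "(nat \<Rightarrow> complex) \<Rightarrow> nat \<Rightarrow> ct poly poly fract \<times> ct poly poly fract" where
  "r_charts \<alpha> i =
    [chart_inf (\<alpha> 0),
     chart_at 0 (\<alpha> 1), chart_at 0 (\<alpha> 1 + \<alpha> 2), chart_at 0 (\<alpha> 1 + \<alpha> 2 + \<alpha> 3),
     chart_at 1 (\<alpha> 4), chart_at 1 (\<alpha> 4 + \<alpha> 5), chart_at 1 (\<alpha> 4 + \<alpha> 5 + \<alpha> 6)] ! i"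

text \<open>The coordinates \<open>r\<^sub>7\<close> as functions of \<open>(x\<^sub>0, y\<^sub>0)\<close>, whose roles are played here by
  \<open>var_q\<close> and \<open>var_p\<close>; to be applied to the Hamiltonian of the system in the coordinates
  \<open>r\<^sub>0\<close>.\<close>

definition r7_chart :: "(nat \<Rightarrow> complex) \<Rightarrow> ct poly poly fract \<times> ct poly poly fract" where
  "r7_chart \<alpha> = chart_at 0 (\<alpha> 7)"


subsection \<open>The Hamiltonian\<close>

definition esym1 :: "complex \<Rightarrow> complex \<Rightarrow> complex \<Rightarrow> complex" where
  "esym1 a b c = a + b + c"

definition esym2 :: "complex \<Rightarrow> complex \<Rightarrow> complex \<Rightarrow> complex" where
  "esym2 a b c = a * b + a * c + b * c"

definition esym3 :: "complex \<Rightarrow> complex \<Rightarrow> complex \<Rightarrow> complex" where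
  "esym3 a b c = a * b * c"

definition I_ham :: "(nat \<Rightarrow> complex) \<Rightarrow> ct poly poly" where
  "I_ham \<alpha> =
    (let q = var_q; p = var_p;
         \<kappa> = 2 * \<alpha> 0 + \<alpha> 7; \<epsilon> = \<alpha> 0 * (\<alpha> 0 + \<alpha> 7); \<delta> = \<kappa>\<^sup>2 + 2 * \<epsilon>;
         \<beta>1 = esym1 (\<alpha> 1) (\<alpha> 1 + \<alpha> 2) (\<alpha> 1 + \<alpha> 2 + \<alpha> 3);
         \<beta>2 = esym2 (\<alpha> 1) (\<alpha> 1 + \<alpha> 2) (\<alpha> 1 + \<alpha> 2 + \<alpha> 3);
         \<beta>3 = esym3 (\<alpha> 1) (\<alpha> 1 + \<alpha> 2) (\<alpha> 1 + \<alpha> 2 + \<alpha> 3);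
         \<gamma>2 = esym2 (\<alpha> 4) (\<alpha> 4 + \<alpha> 5) (\<alpha> 4 + \<alpha> 5 + \<alpha> 6);
         \<gamma>3 = esym3 (\<alpha> 4) (\<alpha> 4 + \<alpha> 5) (\<alpha> 4 + \<alpha> 5 + \<alpha> 6);
         f2 = \<kappa> * (\<gamma>2 - \<beta>2) - \<kappa> ^ 3 - 2 * \<kappa> * \<epsilon> - \<kappa>\<^sup>2 * \<beta>1 + \<epsilon> * \<beta>1;
         b = \<gamma>2 - \<beta>2 - \<kappa>\<^sup>2 - \<epsilon> - \<kappa> * \<beta>1
     in q ^ 3 * (q - 1) ^ 3 * p ^ 4
        + q\<^sup>2 * (q - 1)\<^sup>2 * (const (2 * \<kappa>) * q + const \<beta>1) * p ^ 3
        + q * (q - 1) * (const \<delta> * q\<^sup>2 + const (\<gamma>2 - \<beta>2 - \<delta>) * q + const \<beta>2) * p\<^sup>2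
        + (const (2 * \<kappa> * \<epsilon>) * q ^ 3 + const f2 * q\<^sup>2
           - const (2 * \<kappa> * \<epsilon> + f2 + \<beta>3 + \<gamma>3) * q + const \<beta>3) * p
        + const (\<epsilon>\<^sup>2) * q\<^sup>2 + const (\<epsilon> * b) * q)"

end

theory Submission
  imports Defs
begin

text \<open>
  The Euler derivative \<open>(q - c) \<partial>H/\<partial>q - p \<partial>H/\<partial>p\<close> equals, up to sign, \<open>x \<partial>K/\<partial>x - y \<partial>K/\<partial>y\<close> in each
  chart. It acts on the part of weight \<open>k\<close> as multiplication by \<open>-k\<close>, so comparing weights gives
  divisibility conditions: if \<open>R\<^sub>k(v) p\<^sup>k\<close>, with \<open>v = p (q - c)\<close>, is the part of \<open>H\<close> of weight \<open>k \<ge> 1\<close>,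
  a chart \<open>(-(v - a) p, 1/p)\<close> forces \<open>(v - a)\<^sup>k\<close> to divide \<open>R\<^sub>k\<close>, and the charts \<open>r\<^sub>0\<close>, \<open>r\<^sub>7\<close> force
  \<open>(u + \<alpha>\<^sub>0)\<^sup>k (u + \<alpha>\<^sub>0 + \<alpha>\<^sub>7)\<^sup>k\<close> to divide the coefficient \<open>Q\<^sub>k(u)\<close> of \<open>q\<^sup>k\<close>, where \<open>u = q p\<close>.
  Degree \<open>10\<close> then leaves only \<open>k \<le> 1\<close> at \<open>q = 0, 1\<close> and \<open>k \<le> 2\<close> at infinity, so the coefficient of
  \<open>p\<^sup>j\<close> is divisible by \<open>(q (q - 1))\<^sup>j\<^sup>-\<^sup>1\<close> and has degree at most \<open>j + 2\<close>. The remaining coefficients are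
  read off from \<open>Q\<^sub>2\<close>, \<open>Q\<^sub>1\<close> and the two cubics \<open>R\<^sub>1\<close>, and are multiples of the leading one.
\<close>

subsection \<open>Evaluation and weights\<close>

text \<open>Provides that \<open>ct\<close> is infinite, so that identities checked at all points of
  \<open>ct\<close> become identities between polynomials.\<close>

instance fract :: ("{idom, ring_char_0}") field_char_0
  by standard (auto intro!: injI simp: of_nat_fract eq_fract)

definition ev :: "'a::comm_ring_1 poly poly \<Rightarrow> 'a \<Rightarrow> 'a \<Rightarrow> 'a" where
  "ev f u v = poly (poly f [:v:]) u"

lemma ev_simps [simp]:
  "ev (f + g) u v = ev f u v + ev g u v" "ev (f - g) u v = ev f u v - ev g u v"
  "ev (f * g) u v = ev f u v * ev g u v" "ev (- f) u v = - ev f u v"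
  "ev (f ^ n) u v = ev f u v ^ n" "ev 0 u v = 0" "ev 1 u v = 1"
  "ev (numeral m) u v = numeral m"
  by (simp_all add: ev_def)

lemma poly_eq_sum_bound:
  fixes p :: "'a::comm_ring_1 poly"
  assumes "degree p \<le> n"
  shows "poly p x = (\<Sum>i\<le>n. coeff p i * x ^ i)"
proof -
  have "poly p x = poly (\<Sum>i\<le>n. monom (coeff p i) i) x"
    using poly_as_sum_of_monoms'[OF assms] by simp
  also have "\<dots> = (\<Sum>i\<le>n. coeff p i * x ^ i)" unfolding poly_sum poly_monom ..
  finally show ?thesis .
qed

definition deg_bound :: "'a::zero poly poly \<Rightarrow> nat \<Rightarrow> bool" where
  "deg_bound f n \<longleftrightarrow> degree f \<le> n \<and> (\<forall>j. degree (coeff f j) \<le> n)"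

lemma deg_bound_exists: "\<exists>n0. \<forall>n\<ge>n0. deg_bound f n"
proof -
  let ?n = "degree f + (\<Sum>j\<le>degree f. degree (coeff f j))"
  have "degree (coeff f j) \<le> ?n" for j
  proof (cases "j \<le> degree f")
    case True
    then have "degree (coeff f j) \<le> (\<Sum>j\<le>degree f. degree (coeff f j))"
      by (intro member_le_sum) auto
    then show ?thesis by simp
  qed (simp add: coeff_eq_0)
  then show ?thesis
    unfolding deg_bound_def by (metis le_add1 le_trans)
qed

lemma deg_boundD:
  assumes "deg_bound f n" "n < i \<or> n < j"
  shows "coeff (coeff f j) i = 0"
  using assms unfolding deg_bound_def
  by (metis coeff_0 coeff_eq_0 le_less_trans)

lemma ev_eq_sum:
  assumes "deg_bound f n"
  shows "ev f u v = (\<Sum>j\<le>n. \<Sum>i\<le>n. coeff (coeff f j) i * u ^ i * v ^ j)"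
proof -
  have "ev f u v = (\<Sum>j\<le>n. poly (coeff f j) u * v ^ j)"
    using assms unfolding ev_def deg_bound_def
    by (simp add: poly_eq_sum_bound[of f n] poly_sum poly_const_pow[symmetric] flip: poly_const_conv)
  also have "\<dots> = (\<Sum>j\<le>n. \<Sum>i\<le>n. coeff (coeff f j) i * u ^ i * v ^ j)"
    using assms unfolding deg_bound_def
    by (simp add: poly_eq_sum_bound[of "coeff f _" n] sum_distrib_right)
  finally show ?thesis .
qed

text \<open>Give \<open>q\<close> weight \<open>-1\<close> and \<open>p\<close> weight \<open>1\<close>. With \<open>u = q p\<close>, the part of \<open>f\<close> of weight \<open>k \<ge> 0\<close> is \<open>p\<^sup>k\<close>
  times \<open>wt_p f k\<close> evaluated at \<open>u\<close>, and the part of weight \<open>-k\<close> is \<open>q\<^sup>k\<close> times \<open>wt_q f k\<close>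
  evaluated at \<open>u\<close>.\<close>

definition wt_p :: "'a::comm_ring_1 poly poly \<Rightarrow> nat \<Rightarrow> 'a poly" where
  "wt_p f k = (\<Sum>i\<le>degree f. monom (coeff (coeff f (i + k)) i) i)"

definition wt_q :: "'a::comm_ring_1 poly poly \<Rightarrow> nat \<Rightarrow> 'a poly" where
  "wt_q f k = (\<Sum>j\<le>degree f. monom (coeff (coeff f j) (j + k)) j)"

lemma coeff_wt_p [simp]: "coeff (wt_p f k) i = coeff (coeff f (i + k)) i"
  by (auto simp: wt_p_def coeff_sum sum.delta coeff_eq_0)

lemma coeff_wt_q [simp]: "coeff (wt_q f k) j = coeff (coeff f j) (j + k)"
  by (auto simp: wt_q_def coeff_sum sum.delta coeff_eq_0)

lemma poly_zero_off_0:
  fixes p :: "'a::field_char_0 poly"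
  assumes "\<And>x. x \<noteq> 0 \<Longrightarrow> poly p x = 0"
  shows "p = 0"
proof (rule ccontr)
  assume "p \<noteq> 0"
  then have "finite {x. poly p x = 0}" by (rule poly_roots_finite)
  moreover have "UNIV - {0} \<subseteq> {x. poly p x = 0}" using assms by auto
  ultimately have "finite (UNIV - {0::'a})" by (rule rev_finite_subset)
  then show False by (simp add: infinite_UNIV_char_0)
qed

text \<open>The products \<open>a * b\<close> and \<open>a' * b'\<close> do not change along the two
  curves, and the parts \<open>wt_p f k\<close> and \<open>wt_q g k\<close> are those that scale by
  the power -k of \<tau>. A field of characteristic 0 is infinite, so the coefficients of this power
  agree.\<close>

lemma weight_compare:
  fixes f g :: "'a::field_char_0 poly poly"
  assumes eq: "\<And>\<tau>. \<tau> \<noteq> 0 \<Longrightarrow> ev f (a * \<tau>) (b / \<tau>) = ev g (a' / \<tau>) (b' * \<tau>)"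
  shows "b ^ k * poly (wt_p f k) (a * b) = a' ^ k * poly (wt_q g k) (a' * b')"
proof -
  obtain n1 n2 where n12: "\<And>n. n \<ge> n1 \<Longrightarrow> deg_bound f n" "\<And>n. n \<ge> n2 \<Longrightarrow> deg_bound g n"
    using deg_bound_exists by metis
  define n where "n = n1 + n2 + k"
  have bf: "deg_bound f n" and bg: "deg_bound g n" and kn: "k \<le> n" using n12 by (auto simp: n_def)
  \<comment> \<open>Multiplying by the power \<open>n\<close> of \<tau> turns the Laurent
    polynomials into polynomials. The subtractions are exact for indices up to \<open>n\<close>, and
    the power -k becomes \<open>n - k\<close>.\<close>
  define F where "F = (\<Sum>j\<le>n. \<Sum>i\<le>n. monom (coeff (coeff f j) i * a ^ i * b ^ j) (n + i - j))"
  define G where "G = (\<Sum>j\<le>n. \<Sum>i\<le>n. monom (coeff (coeff g j) i * a' ^ i * b' ^ j) (n + j - i))"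
  have "poly (F - G) \<tau> = 0" if t: "\<tau> \<noteq> 0" for \<tau>
  proof -
    have pw: "\<tau> ^ (i + n - j) = \<tau> ^ n * \<tau> ^ i / \<tau> ^ j" if "j \<le> n" for i j
      using that t by (simp add: power_diff power_add mult.commute)
    have "poly F \<tau> = \<tau> ^ n * ev f (a * \<tau>) (b / \<tau>)"
      unfolding F_def ev_eq_sum[OF bf]
      by (simp add: poly_sum poly_monom sum_distrib_left pw power_mult_distrib power_divide ac_simps cong: sum.cong_simp)
    moreover have "poly G \<tau> = \<tau> ^ n * ev g (a' / \<tau>) (b' * \<tau>)"
      unfolding G_def ev_eq_sum[OF bg]
      by (simp add: poly_sum poly_monom sum_distrib_left pw power_mult_distrib power_divide ac_simps cong: sum.cong_simp)
    ultimately show ?thesis using eq[OF t] by simp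
  qed
  then have "F = G" using poly_zero_off_0[of "F - G"] by simp
  have "coeff F (n - k) = (\<Sum>i\<le>n. \<Sum>j\<le>n. if i + k = j then coeff (coeff f j) i * a ^ i * b ^ j else 0)"
    unfolding F_def coeff_sum coeff_monom
    by (subst sum.swap, intro sum.cong refl if_cong) (use kn in auto)
  also have "\<dots> = (\<Sum>i\<le>n. coeff (coeff f (i + k)) i * a ^ i * b ^ (i + k))"
    using deg_boundD[OF bf] by (intro sum.cong refl) (auto simp: sum.delta')
  also have "\<dots> = b ^ k * (\<Sum>i\<le>n. coeff (wt_p f k) i * (a * b) ^ i)"
    by (simp add: sum_distrib_left power_mult_distrib power_add ac_simps)
  also have "(\<Sum>i\<le>n. coeff (wt_p f k) i * (a * b) ^ i) = poly (wt_p f k) (a * b)"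
    by (rule poly_eq_sum_bound[symmetric], rule degree_le) (use deg_boundD[OF bf] in auto)
  finally have 1: "coeff F (n - k) = b ^ k * poly (wt_p f k) (a * b)" .
  have "coeff G (n - k) = (\<Sum>j\<le>n. \<Sum>i\<le>n. if j + k = i then coeff (coeff g j) i * a' ^ i * b' ^ j else 0)"
    unfolding G_def coeff_sum coeff_monom
    by (intro sum.cong refl if_cong) (use kn in auto)
  also have "\<dots> = (\<Sum>j\<le>n. coeff (coeff g j) (j + k) * a' ^ (j + k) * b' ^ j)"
    using deg_boundD[OF bg] by (intro sum.cong refl) (auto simp: sum.delta')
  also have "\<dots> = a' ^ k * (\<Sum>j\<le>n. coeff (wt_q g k) j * (a' * b') ^ j)"
    by (simp add: sum_distrib_left power_mult_distrib power_add ac_simps)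
  also have "(\<Sum>j\<le>n. coeff (wt_q g k) j * (a' * b') ^ j) = poly (wt_q g k) (a' * b')"
    by (rule poly_eq_sum_bound[symmetric], rule degree_le) (use deg_boundD[OF bg] in auto)
  finally have 2: "coeff G (n - k) = a' ^ k * poly (wt_q g k) (a' * b')" .
  show ?thesis using 1 2 \<open>F = G\<close> by simp
qed

text \<open>Specialization of a rational function at a point, as a relation: it has no value at a point
  where every admissible denominator vanishes.\<close>

definition specializes :: "'a::idom \<Rightarrow> 'a \<Rightarrow> 'a poly poly fract \<Rightarrow> 'a \<Rightarrow> bool" where
  "specializes u v z l \<longleftrightarrow>
     (\<exists>f g. ev g u v \<noteq> 0 \<and> z * to_fract g = to_fract f \<and> l * ev g u v = ev f u v)"

lemma specializes_to_fract: "specializes u v (to_fract f) (ev f u v)"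
  unfolding specializes_def by (rule exI[of _ f], rule exI[of _ 1]) simp

lemma specializes_inverse:
  fixes u v :: "'a::field"
  assumes "ev f u v \<noteq> 0"
  shows "specializes u v (1 / to_fract f) (1 / ev f u v)"
  unfolding specializes_def
  by (rule exI[of _ 1], rule exI[of _ f]) (use assms in auto)

lemma specializesI:
  assumes "ev g u v \<noteq> 0" "z * to_fract g = to_fract f" "l * ev g u v = ev f u v"
  shows "specializes u v z l"
  using assms unfolding specializes_def by blast

lemma specializes_add:
  assumes "specializes u v z l" "specializes u v z' l'"
  shows "specializes u v (z + z') (l + l')"
proof -
  obtain f g f' g' where *: "ev g u v \<noteq> 0" "z * to_fract g = to_fract f" "l * ev g u v = ev f u v"
    "ev g' u v \<noteq> 0" "z' * to_fract g' = to_fract f'" "l' * ev g' u v = ev f' u v"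
    using assms unfolding specializes_def by blast
  show ?thesis
    by (rule specializesI[of "g * g'" _ _ _ "f * g' + f' * g"])
      (use *(1,4) in \<open>simp_all add: algebra_simps flip: *(2,3,5,6)\<close>)
qed

lemma specializes_mult:
  assumes "specializes u v z l" "specializes u v z' l'"
  shows "specializes u v (z * z') (l * l')"
proof -
  obtain f g f' g' where *: "ev g u v \<noteq> 0" "z * to_fract g = to_fract f" "l * ev g u v = ev f u v"
    "ev g' u v \<noteq> 0" "z' * to_fract g' = to_fract f'" "l' * ev g' u v = ev f' u v"
    using assms unfolding specializes_def by blast
  show ?thesis
    by (rule specializesI[of "g * g'" _ _ _ "f * f'"])
      (use *(1,4) in \<open>simp_all add: algebra_simps flip: *(2,3,5,6)\<close>)
qed

lemma specializes_uminus: "specializes u v z l \<Longrightarrow> specializes u v (- z) (- l)"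
  using specializes_mult[OF specializes_to_fract[of u v "- 1"]] by fastforce

text \<open>Cross-multiplication gives an equation of polynomials because \<open>to_fract\<close> is
  injective. This is how equations of motion between rational functions become equations of values
  in \<open>ct\<close>.\<close>

lemma specializes_unique:
  assumes "specializes u v z l" "specializes u v z l'"
  shows "l = l'"
proof -
  obtain f g f' g' where *: "ev g u v \<noteq> 0" "z * to_fract g = to_fract f" "l * ev g u v = ev f u v"
    "ev g' u v \<noteq> 0" "z * to_fract g' = to_fract f'" "l' * ev g' u v = ev f' u v"
    using assms unfolding specializes_def by blast
  have "to_fract (f * g') = to_fract (f' * g)"
    using *(2,5) by (simp flip: *(2,5))
  then have "ev (f * g') u v = ev (f' * g) u v" unfolding to_fract_eq_iff by simp
  then have "(l - l') * (ev g u v * ev g' u v) = 0"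
    using *(3,6) by simp algebra
  then show ?thesis using *(1,4) by simp
qed

text \<open>Horner's scheme in each of the two variables, since specialization respects sums and
  products.\<close>

lemma specializes_subst2:
  assumes "specializes u v x a" "specializes u v y b"
  shows "specializes u v (subst2 K x y) (ev K a b)"
proof -
  have *: "specializes u v (poly (map_poly (\<lambda>c. to_fract [:[:c:]:]) p) x) (poly p a)" for p
  proof (induction p)
    case 0
    then show ?case using specializes_to_fract[of u v 0] by simp
  next
    case (pCons c p)
    have "specializes u v (to_fract [:[:c:]:]) c"
      using specializes_to_fract[of u v "[:[:c:]:]"] by (simp add: ev_def)
    then show ?case
      using pCons assms(1) by (simp add: map_poly_pCons specializes_add specializes_mult)
  qed
  show ?thesis
  proof (induction K)
    case 0
    then show ?case using specializes_to_fract[of u v 0] by (simp add: subst2_def)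
  next
    case (pCons c K)
    then show ?case
      using *[of c] assms(2)
      by (simp add: map_poly_pCons subst2_def ev_def specializes_add specializes_mult)
  qed
qed

subsection \<open>Charts and the Euler derivative\<close>

definition emb :: "complex \<Rightarrow> ct" where "emb c = to_fract [:c:]"

lemma emb_simps [simp]:
  "emb (a + b) = emb a + emb b" "emb (a - b) = emb a - emb b" "emb (a * b) = emb a * emb b"
  "emb (- a) = - emb a" "emb (a ^ n) = emb a ^ n" "emb 0 = 0" "emb 1 = 1"
proof -
  show m: "emb (a * b) = emb a * emb b" for a b
    by (simp add: emb_def flip: to_fract_mult)
  show "emb 1 = 1" by (simp add: emb_def flip: one_pCons)
  then show "emb (a ^ n) = emb a ^ n" by (induction n) (simp_all add: m)
qed (simp_all add: emb_def flip: to_fract_add to_fract_diff to_fract_uminus)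

lemma emb_of_nat [simp]: "emb (of_nat n) = of_nat n"
  by (induction n) simp_all

lemma emb_numeral [simp]: "emb (numeral n) = numeral n"
  using emb_of_nat[of "numeral n"] by simp

lemma emb_eq_iff [simp]: "emb a = emb b \<longleftrightarrow> a = b"
  by (simp add: emb_def)

lemma const_eq_emb: "const c = [:[:emb c:]:]"
  by (simp add: const_def emb_def)

lemma ev_var [simp]:
  "ev var_q u v = u" "ev var_p u v = v" "ev (const c) u v = emb c"
  by (simp_all add: ev_def var_q_def var_p_def const_eq_emb)

lemma ev_pCons: "ev (pCons h f) u v = poly h u + v * ev f u v"
  by (simp add: ev_def)

text \<open>Moves the point q = e to the origin, so that the weights there describe the charts at q
  = e.\<close>

definition shift :: "'a::comm_ring_1 \<Rightarrow> 'a poly poly \<Rightarrow> 'a poly poly" where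
  "shift e f = map_poly (\<lambda>h. pcompose h [:e, 1:]) f"

lemma coeff_shift: "coeff (shift e f) j = pcompose (coeff f j) [:e, 1:]"
  by (simp add: shift_def coeff_map_poly)

lemma ev_shift: "ev (shift e f) z v = ev f (e + z) v"
  unfolding shift_def
  by (induction f) (simp_all add: map_poly_pCons ev_pCons poly_pcompose)

lemma shift_pderiv:
  fixes f :: "'a::idom poly poly"
  shows "pderiv (shift e f) = shift e (pderiv f)"
    and "map_poly pderiv (shift e f) = shift e (map_poly pderiv f)"
proof -
  have *: "pcompose (of_nat n) r = of_nat n" for n and r :: "'a poly"
    by (simp add: of_nat_poly)
  show "pderiv (shift e f) = shift e (pderiv f)"
    by (rule poly_eqI) (simp add: coeff_pderiv coeff_shift pcompose_mult * del: of_nat_Suc)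
  show "map_poly pderiv (shift e f) = shift e (map_poly pderiv f)"
    by (rule poly_eqI) (simp add: coeff_map_poly coeff_shift pderiv_pcompose pderiv_pCons)
qed

text \<open>Up to sign this derivative has the same form in every chart, since
  \<open>y \<partial>K/\<partial>y - x \<partial>K/\<partial>x\<close> equals \<open>y x' + x y'\<close> along the flow.\<close>

definition euler :: "ct poly poly \<Rightarrow> ct poly poly" where
  "euler f = var_q * pd_q f - var_p * pd_p f"

lemma coeff_euler: "coeff (coeff (euler f) j) i = (of_nat i - of_nat j) * coeff (coeff f j) i"
proof -
  have "coeff (coeff (var_q * pd_q f) j) i = of_nat i * coeff (coeff f j) i"
    by (cases i) (simp_all add: var_q_def coeff_map_poly coeff_pderiv coeff_pCons del: of_nat_Suc)
  moreover have "coeff (coeff (var_p * pd_p f) j) i = of_nat j * coeff (coeff f j) i"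
    by (cases j) (simp_all add: var_p_def coeff_pderiv coeff_pCons of_nat_poly del: of_nat_Suc)
  ultimately show ?thesis by (simp add: euler_def algebra_simps)
qed

lemma wt_euler:
  "wt_p (euler f) k = smult (- of_nat k) (wt_p f k)"
  "wt_q (euler f) k = smult (of_nat k) (wt_q f k)"
  "wt_p (- euler f) k = smult (of_nat k) (wt_p f k)"
  "wt_q (- euler f) k = smult (- of_nat k) (wt_q f k)"
  by (auto intro!: poly_eqI simp: coeff_euler)

text \<open>The charts have constant coefficients, so the explicit time derivative contributes
  nothing to the flow of their coordinates.\<close>

lemma pd_t_basic:
  "pd_t var_q = 0" "pd_t var_p = 0" "pd_t (const c) = 0"
  "pd_t (a + b) = pd_t a + pd_t b" "pd_t (a - b) = pd_t a - pd_t b" "pd_t (- b) = - pd_t b"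
proof -
  have p: "pderiv (a * b) = pderiv a * b + a * pderiv b" for a b :: "complex poly"
    by (simp add: pderiv_mult algebra_simps)
  note D = fract_derivation[OF pderiv_add p] fract_deriv_to_fract[OF p]
  have emb: "fract_deriv pderiv (emb c) = 0" for c
    by (simp add: emb_def D)
  from emb[of 0] emb[of 1] have 01: "fract_deriv pderiv (0::ct) = 0" "fract_deriv pderiv (1::ct) = 0"
    by simp_all
  show "pd_t var_q = 0" "pd_t var_p = 0" "pd_t (const c) = 0"
    by (simp_all add: var_q_def var_p_def const_eq_emb map_poly_pCons 01 emb one_pCons)
  show add: "pd_t (a + b) = pd_t a + pd_t b" for a b
    by (rule map_poly_derivation, rule map_poly_derivation, rule D, rule D)
      (rule map_poly_derivation, rule D, rule D)
  have "pd_t 0 = 0" by simp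
  then show min: "pd_t (- b) = - pd_t b" for b
    using add[of b "- b"] by (metis add.right_inverse neg_eq_iff_add_eq_0 add_eq_0_iff)
  show "pd_t (a - b) = pd_t a - pd_t b"
    using add[of a "- b"] min by simp
qed

lemmas flow_simps = fract_deriv_pd pd_basic pd_derivation pd_linear pd_t_basic

text \<open>Specializing the two equations of motion yields both partial derivatives of
  \<open>K\<close> at the image point. In the combination x K_x - y K_y the terms with
  \<open>a\<close> cancel. No relation between \<open>H\<close> and \<open>K\<close> themselves is
  needed.\<close>

lemma chart_at_euler:
  assumes "has_hamiltonian_in H (chart_at c a) K" and v: "v \<noteq> 0"
  shows "ev (euler (shift (emb c) H)) z v = - ev (euler K) (- ((v * z - emb a) * v)) (1 / v)"
proof -
  define X where "X = - ((var_p * (var_q - const c) - const a) * var_p)"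
  define u where "u = emb c + z"
  let ?x = "- ((v * z - emb a) * v)" and ?y = "1 / v"
  have H: "flow_deriv H (to_fract X) = subst2 (pd_p K) (to_fract X) (1 / to_fract var_p)"
    "flow_deriv H (1 / to_fract var_p) = - subst2 (pd_q K) (to_fract X) (1 / to_fract var_p)"
    using assms(1) by (simp_all add: has_hamiltonian_in_def chart_at_def X_def)
  have X: "pd_q X = - (var_p * var_p)" "pd_p X = - (2 * var_p * (var_q - const c) - const a)"
    "pd_t X = 0"
    unfolding X_def by (simp_all add: flow_simps algebra_simps)
  have fx: "flow_deriv H (to_fract X) =
      to_fract (- (var_p * var_p) * pd_p H + (2 * var_p * (var_q - const c) - const a) * pd_q H)"
    by (simp add: flow_deriv_def fract_deriv_pd X algebra_simps)
  have fy: "flow_deriv H (1 / to_fract var_p) = to_fract (pd_q H) * (1 / to_fract var_p * (1 / to_fract var_p))"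
    by (simp add: flow_deriv_def flow_simps power2_eq_square)
  have sx: "specializes u v (to_fract X) ?x"
    using specializes_to_fract[of u v X] by (simp add: X_def u_def)
  have sy: "specializes u v (1 / to_fract var_p) ?y"
    using specializes_inverse[of var_p u v] v by simp
  have "specializes u v (flow_deriv H (to_fract X)) (ev (pd_p K) ?x ?y)"
    unfolding H(1) by (intro specializes_subst2 sx sy)
  from specializes_unique[OF this[unfolded fx] specializes_to_fract]
  have 1: "ev (pd_p K) ?x ?y = - (v * v) * ev (pd_p H) u v + (2 * v * z - emb a) * ev (pd_q H) u v"
    by (simp add: u_def)
  have "specializes u v (flow_deriv H (1 / to_fract var_p)) (- ev (pd_q K) ?x ?y)"
    unfolding H(2) by (intro specializes_uminus specializes_subst2 sx sy)
  from specializes_unique[OF this[unfolded fy] specializes_mult[OF specializes_to_fract specializes_mult[OF sy sy]]]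
  have 2: "ev (pd_q K) ?x ?y = - (ev (pd_q H) u v * (?y * ?y))"
    by (metis minus_minus)
  show ?thesis
    using v by (simp add: euler_def shift_pderiv ev_shift 1 2 flip: u_def) (simp add: field_simps)
qed

text \<open>The same computation and the same cancellation, now with x as the reciprocal and the
  parameter in y.\<close>

lemma chart_inf_euler:
  assumes "has_hamiltonian_in H (chart_inf a) K" and u: "u \<noteq> 0"
  shows "ev (euler H) u v = - ev (euler K) (1 / u) (- ((u * v + emb a) * u))"
proof -
  define Y where "Y = - ((var_q * var_p + const a) * var_q)"
  let ?x = "1 / u" and ?y = "- ((u * v + emb a) * u)"
  have H: "flow_deriv H (1 / to_fract var_q) = subst2 (pd_p K) (1 / to_fract var_q) (to_fract Y)"
    "flow_deriv H (to_fract Y) = - subst2 (pd_q K) (1 / to_fract var_q) (to_fract Y)"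
    using assms(1) by (simp_all add: has_hamiltonian_in_def chart_inf_def Y_def)
  have Y: "pd_q Y = - (2 * var_q * var_p + const a)" "pd_p Y = - (var_q * var_q)" "pd_t Y = 0"
    unfolding Y_def by (simp_all add: flow_simps algebra_simps)
  have fx: "flow_deriv H (1 / to_fract var_q) =
      to_fract (- pd_p H) * (1 / to_fract var_q * (1 / to_fract var_q))"
    by (simp add: flow_deriv_def flow_simps power2_eq_square)
  have fy: "flow_deriv H (to_fract Y) =
      to_fract (- (2 * var_q * var_p + const a) * pd_p H + var_q * var_q * pd_q H)"
    by (simp add: flow_deriv_def fract_deriv_pd Y algebra_simps)
  have sx: "specializes u v (1 / to_fract var_q) ?x"
    using specializes_inverse[of var_q u v] u by simp
  have sy: "specializes u v (to_fract Y) ?y"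
    using specializes_to_fract[of u v Y] by (simp add: Y_def)
  have "specializes u v (flow_deriv H (1 / to_fract var_q)) (ev (pd_p K) ?x ?y)"
    unfolding H(1) by (intro specializes_subst2 sx sy)
  from specializes_unique[OF this[unfolded fx] specializes_mult[OF specializes_to_fract specializes_mult[OF sx sx]]]
  have 1: "ev (pd_p K) ?x ?y = - ev (pd_p H) u v / (u * u)"
    by (simp add: field_simps)
  have "specializes u v (flow_deriv H (to_fract Y)) (- ev (pd_q K) ?x ?y)"
    unfolding H(2) by (intro specializes_uminus specializes_subst2 sx sy)
  from specializes_unique[OF this[unfolded fy] specializes_to_fract]
  have "- ev (pd_q K) ?x ?y =
      - ((2 * u * v + emb a) * ev (pd_p H) u v - u * u * ev (pd_q H) u v)"
    by (simp add: algebra_simps)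
  then have 2: "ev (pd_q K) ?x ?y = (2 * u * v + emb a) * ev (pd_p H) u v - u * u * ev (pd_q H) u v"
    by (metis minus_minus)
  show ?thesis
    using u by (simp add: euler_def 1 2) (simp add: field_simps)
qed

section \<open>Divisibility of the weight parts forced by the charts\<close>

lemma poly_eqI_char_0:
  fixes f g :: "'a::field_char_0 poly"
  assumes "\<And>x. poly f x = poly g x"
  shows "f = g"
  using assms poly_eq_poly_eq_iff[of f g] by auto

lemma power_dvd_power_minus: "x ^ k dvd (- x) ^ k" for x :: "'a::comm_ring_1"
  by (cases "even k") simp_all

text \<open>The part of \<open>H\<close> of weight \<open>k\<close> becomes the part of
  \<open>K\<close> with factor x^k, and x = (a - v) p vanishes to first order at v = a.\<close>

lemma chart_at_weight:
  assumes "poly_hamiltonian_in H (chart_at c a)" and k: "k \<ge> 1"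
  shows "[:- emb a, 1:] ^ k dvd wt_p (shift (emb c) H) k"
proof -
  obtain K where K: "has_hamiltonian_in H (chart_at c a) K"
    using assms(1) by (auto simp: poly_hamiltonian_in_def)
  have "poly (wt_p (shift (emb c) H) k) w = (emb a - w) ^ k * poly (wt_q K k) (emb a - w)" for w
  proof -
    \<comment> \<open>A curve on which the product of the coordinates is \<open>w\<close>; on its
      image the product x y is \<open>emb a - w\<close>.\<close>
    have "ev (euler (shift (emb c) H)) (w * \<tau>) (1 / \<tau>) = ev (- euler K) ((emb a - w) / \<tau>) (1 * \<tau>)"
      if "\<tau> \<noteq> 0" for \<tau>
      using chart_at_euler[OF K, of "1 / \<tau>" "w * \<tau>"] that by (simp add: diff_divide_distrib)
    \<comment> \<open>Both sides carry the factor -k from the Euler derivative; it cancels because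
      \<open>k\<close> is positive.\<close>
    from weight_compare[OF this, of k] show ?thesis
      using k by (simp add: wt_euler)
  qed
  then have "wt_p (shift (emb c) H) k =
      pcompose (monom 1 k * wt_q K k) [:emb a, - 1:]"
    by (intro poly_eqI_char_0) (simp add: poly_pcompose poly_monom)
  also have "\<dots> = [:emb a, - 1:] ^ k * pcompose (wt_q K k) [:emb a, - 1:]"
    by (intro poly_eqI_char_0) (simp add: poly_pcompose poly_monom)
  also have "[:emb a, - 1:] = - [:- emb a, 1:]" by simp
  finally show ?thesis
    using power_dvd_power_minus dvd_mult2 by metis
qed

text \<open>The part of \<open>H\<close> with factor q^k becomes the part of \<open>K\<close> with
  factor y^k. Here y = -(u + a) q supplies (u + a)^k, and the chart of \<open>K\<close> supplies (x
  y - a')^k with x y = -(u + a). The product divides even if the two roots coincide.\<close>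

lemma chart_inf_weight:
  assumes K: "has_hamiltonian_in H (chart_inf a) K" and K': "poly_hamiltonian_in K (chart_at 0 a')"
    and k: "k \<ge> 1"
  shows "[:emb a, 1:] ^ k * [:emb (a + a'), 1:] ^ k dvd wt_q H k"
proof -
  have "shift 0 K = K" by (rule poly_eqI) (simp add: coeff_shift pcompose_idR)
  then obtain T where T: "wt_p K k = [:- emb a', 1:] ^ k * T"
    using chart_at_weight[OF K' k] by (auto elim: dvdE)
  have "w ^ k * poly (wt_p K k) w = poly (wt_q H k) (- (emb a + w))" for w
  proof -
    have "ev (- euler K) (1 * \<tau>) (w / \<tau>) = ev (euler H) (1 / \<tau>) (- (emb a + w) * \<tau>)"
      if "\<tau> \<noteq> 0" for \<tau>
      using chart_inf_euler[OF K, of "1 / \<tau>" "- (emb a + w) * \<tau>"] that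
      by (simp add: field_simps)
    from weight_compare[OF this, of k] show ?thesis
      using k by (simp add: wt_euler)
  qed
  from this[of "- (emb a + u)" for u]
  have "wt_q H k = [:- emb a, - 1:] ^ k * ([:- emb (a + a'), - 1:] ^ k * pcompose T [:- emb a, - 1:])"
    by (intro poly_eqI_char_0) (simp add: poly_pcompose T algebra_simps)
  also have "[:- emb a, - 1:] = - [:emb a, 1:]" by simp
  also have "[:- emb (a + a'), - 1:] = - [:emb (a + a'), 1:]" by simp
  finally show ?thesis
    by (simp only: mult.assoc[symmetric] mult_dvd_mono power_dvd_power_minus dvd_mult2) 
qed

subsection \<open>Divisibility and support\<close>

lemma linear_power_dvd_cancel:
  fixes a b :: "'a::field"
  assumes "a \<noteq> b" "[:- b, 1:] ^ k dvd [:- a, 1:] ^ n * s"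
  shows "[:- b, 1:] ^ k dvd s"
proof (cases "s = 0")
  case False
  then have ne: "[:- a, 1:] ^ n * s \<noteq> 0" by simp
  have "order b ([:- a, 1:] ^ n) = 0"
    using assms(1) by (intro order_0I) (simp add: poly_power)
  then show ?thesis
    using assms(2) ne by (simp add: order_divides order_mult)
qed simp

lemma linear_powers_dvd:
  fixes a b :: "'a::field"
  assumes "a \<noteq> b" "[:- a, 1:] ^ m dvd f" "[:- b, 1:] ^ n dvd f"
  shows "[:- a, 1:] ^ m * [:- b, 1:] ^ n dvd f"
proof -
  obtain s where s: "f = [:- a, 1:] ^ m * s" using assms(2) by (auto elim: dvdE)
  then have "[:- b, 1:] ^ n dvd s"
    using assms(1,3) linear_power_dvd_cancel by blast
  then show ?thesis unfolding s by (rule mult_dvd_mono[OF dvd_refl])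
qed

lemma linear_powers_dvd3:
  fixes a b c :: "'a::field"
  assumes "a \<noteq> b" "a \<noteq> c" "b \<noteq> c"
    "[:- a, 1:] ^ k dvd f" "[:- b, 1:] ^ l dvd f" "[:- c, 1:] ^ m dvd f"
  shows "[:- a, 1:] ^ k * ([:- b, 1:] ^ l * [:- c, 1:] ^ m) dvd f"
proof -
  obtain s where s: "f = [:- a, 1:] ^ k * s" using assms(4) by (auto elim: dvdE)
  then have "[:- b, 1:] ^ l dvd s" "[:- c, 1:] ^ m dvd s"
    using assms linear_power_dvd_cancel by blast+
  then show ?thesis
    unfolding s using linear_powers_dvd[OF assms(3)] by (intro mult_dvd_mono dvd_refl)
qed

lemma degree_factor_le:
  fixes f s :: "'a::idom poly"
  assumes "degree (f * s) \<le> degree f + n" "f \<noteq> 0"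
  shows "degree s \<le> n"
  using assms by (cases "s = 0") (simp_all add: degree_mult_eq)

section \<open>Vanishing of weight parts in total degree 10\<close>

definition total_bound :: "'a::zero poly poly \<Rightarrow> nat \<Rightarrow> bool" where
  "total_bound f n \<longleftrightarrow> (\<forall>i j. n < i + j \<longrightarrow> coeff (coeff f j) i = 0)"

lemma total_bound_total_degree: "total_bound H (total_degree H)"
  unfolding total_bound_def
proof (intro allI impI, rule ccontr)
  fix i j assume ij: "total_degree H < i + j" "coeff (coeff H j) i \<noteq> 0"
  obtain n where n: "deg_bound H n" using deg_bound_exists by blast
  let ?S = "{i + j |i j. coeff (coeff H j) i \<noteq> 0}"
  have "?S \<subseteq> {..n + n}"
    using deg_boundD[OF n] by (auto simp: not_less intro!: add_mono) (meson not_le)+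
  then have "finite ?S" by (rule finite_subset) simp
  then have "i + j \<le> total_degree H"
    unfolding total_degree_def using ij(2) by (intro Max_ge) auto
  then show False using ij(1) by simp
qed

lemma total_bound_degree_coeff:
  assumes "total_bound f n" "coeff f j \<noteq> 0"
  shows "degree (coeff f j) + j \<le> n"
proof (rule ccontr)
  assume "\<not> ?thesis"
  then have "coeff (coeff f j) (degree (coeff f j)) = 0"
    using assms(1) by (simp add: total_bound_def)
  then show False using assms(2) by simp
qed

lemma total_bound_shift:
  fixes f :: "'a::idom poly poly"
  assumes "total_bound f n"
  shows "total_bound (shift c f) n"
  unfolding total_bound_def
proof (intro allI impI)
  fix i j assume *: "n < i + j"
  show "coeff (coeff (shift c f) j) i = 0"
  proof (cases "coeff f j = 0")
    case False
    from total_bound_degree_coeff[OF assms this] * show ?thesis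
      by (auto simp: coeff_shift degree_pcompose intro!: coeff_eq_0)
  qed (simp add: coeff_shift)
qed

text \<open>The term u^i in a part of weight \<open>k\<close> or -k stems from a monomial of total
  degree 2i + k.\<close>

lemma degree_wt:
  fixes f :: "'a::comm_ring_1 poly poly"
  assumes "total_bound f n"
  shows "wt_p f k \<noteq> 0 \<Longrightarrow> 2 * degree (wt_p f k) + k \<le> n"
    and "wt_q f k \<noteq> 0 \<Longrightarrow> 2 * degree (wt_q f k) + k \<le> n"
proof -
  have *: "2 * i + k \<le> n" if "coeff (wt_p f k) i \<noteq> 0 \<or> coeff (wt_q f k) i \<noteq> 0" for i
    using that assms by (auto simp: total_bound_def not_less[symmetric])
  show "wt_p f k \<noteq> 0 \<Longrightarrow> 2 * degree (wt_p f k) + k \<le> n"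
    and "wt_q f k \<noteq> 0 \<Longrightarrow> 2 * degree (wt_q f k) + k \<le> n"
    by (rule *, simp del: coeff_wt_p coeff_wt_q)+
qed

text \<open>Three roots of multiplicity \<open>k\<close> force degree 3k in u, hence total degree at
  least 7k, which is at least 14.\<close>

lemma wt_p_eq_0_three:
  fixes f :: "'a::field poly poly"
  assumes "total_bound f 10" "distinct [r, s, t]" "k \<ge> 2"
    and "\<And>x. x \<in> {r, s, t} \<Longrightarrow> [:- x, 1:] ^ k dvd wt_p f k"
  shows "wt_p f k = 0"
proof (rule ccontr)
  assume ne: "wt_p f k \<noteq> 0"
  have "[:- r, 1:] ^ k * ([:- s, 1:] ^ k * [:- t, 1:] ^ k) dvd wt_p f k"
    using assms by (intro linear_powers_dvd3) auto
  from dvd_imp_degree_le[OF this ne] degree_wt(1)[OF assms(1) ne] show False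
    using assms(3) by (simp add: degree_mult_eq degree_linear_power)
qed

lemma wt_p_two_dvd:
  fixes f :: "'a::field poly poly"
  assumes "r \<noteq> s" "[:- r, 1:] ^ k dvd wt_p f k" "[:- s, 1:] ^ k dvd wt_p f k"
    and "wt_p f k \<noteq> 0"
  shows "2 * k \<le> degree (wt_p f k)"
  using dvd_imp_degree_le[OF linear_powers_dvd[OF assms(1-3)] assms(4)]
  by (simp add: degree_mult_eq degree_linear_power)

lemma pcompose_power: "pcompose (p ^ n) q = pcompose p q ^ n" for p :: "'a::comm_ring_1 poly"
  by (induction n) (simp_all add: pcompose_mult pcompose_1)

text \<open>If weights from \<open>l\<close> on are absent, p^j occurs only with (q - c)^i where j -
  i < l. The truncated exponent is 0 for j < l, where nothing is claimed.\<close>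

lemma shift_low_coeffs_dvd:
  fixes f :: "'a::idom poly poly"
  assumes "\<And>k. k \<ge> l \<Longrightarrow> wt_p (shift c f) k = 0" "l \<ge> 1"
  shows "[:- c, 1:] ^ (j + 1 - l) dvd coeff f j"
proof -
  have "coeff (coeff (shift c f) j) i = 0" if "i < j + 1 - l" for i
    using arg_cong[OF assms(1)[of "j - i"], of "\<lambda>p. coeff p i"] that assms(2) by simp
  then have "monom 1 (j + 1 - l) dvd pcompose (coeff f j) [:c, 1:]"
    by (simp add: monom_1_dvd_iff' coeff_shift)
  then obtain s where "pcompose (coeff f j) [:c, 1:] = monom 1 (j + 1 - l) * s" by (auto elim: dvdE)
  then have "pcompose (pcompose (coeff f j) [:c, 1:]) [:- c, 1:] = [:- c, 1:] ^ (j + 1 - l) * pcompose s [:- c, 1:]"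
    by (simp add: pcompose_mult monom_altdef pcompose_power pcompose_pCons)
  moreover have "pcompose (pcompose (coeff f j) [:c, 1:]) [:- c, 1:] = coeff f j"
    by (simp add: pcompose_assoc[symmetric] pcompose_pCons pcompose_idR)
  ultimately show ?thesis by simp
qed

text \<open>At \<open>c2\<close> only two distinct roots are available, which leaves room for a weight \<open>2\<close> part of
  degree exactly \<open>4\<close>; it is excluded because the three roots at \<open>c1\<close> already bound the degree in
  \<open>p\<close> by \<open>4\<close>.\<close>

lemma support_bound:
  fixes f :: "'a::field poly poly"
  assumes tb: "total_bound f 10" and c: "c1 \<noteq> c2"
    and three: "distinct [r1, r2, r3]"
      "\<And>k x. k \<ge> 1 \<Longrightarrow> x \<in> {r1, r2, r3} \<Longrightarrow> [:- x, 1:] ^ k dvd wt_p (shift c1 f) k"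
    and two: "s1 \<noteq> s2"
      "\<And>k x. k \<ge> 1 \<Longrightarrow> x \<in> {s1, s2} \<Longrightarrow> [:- x, 1:] ^ k dvd wt_p (shift c2 f) k"
  shows "j \<ge> 5 \<Longrightarrow> coeff f j = 0"
    and "[:- c1, 1:] ^ (j - 1) * [:- c2, 1:] ^ (j - 1) dvd coeff f j"
proof -
  note tbs = total_bound_shift[OF tb]
  have w1: "wt_p (shift c1 f) k = 0" if "k \<ge> 2" for k
    using wt_p_eq_0_three[OF tbs three(1) that] three(2) that by auto
  have w2_deg: "2 * k \<le> degree (wt_p (shift c2 f) k)" if "k \<ge> 1" "wt_p (shift c2 f) k \<noteq> 0" for k
    using wt_p_two_dvd[OF two(1)] two(2) that by auto
  \<comment> \<open>Two roots of multiplicity \<open>k\<close> force total degree at least 5k; this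
    excludes k = 3 but only just admits k = 2.\<close>
  have w2: "wt_p (shift c2 f) k = 0" if "k \<ge> 3" for k
    using w2_deg[of k] degree_wt(1)[OF tbs, of c2 k] that by fastforce
  have d1: "[:- c1, 1:] ^ (j - 1) dvd coeff f j" for j
    using shift_low_coeffs_dvd[of 2 c1 f j] w1 by (simp add: numeral_2_eq_2)
  have d2: "[:- c2, 1:] ^ (j - 2) dvd coeff f j" for j
    using shift_low_coeffs_dvd[of 3 c2 f j] w2 by (simp add: numeral_eq_Suc)
  show *: "coeff f j = 0" if "j \<ge> 5" for j
  proof (rule ccontr)
    assume ne: "coeff f j \<noteq> 0"
    \<comment> \<open>The total degree would be at least (j - 1) + (j - 2) + j, which is at least
      12.\<close>
    from dvd_imp_degree_le[OF linear_powers_dvd[OF c d1 d2] ne] total_bound_degree_coeff[OF tb ne] that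
    show False by (simp add: degree_mult_eq degree_linear_power)
  qed
  have "wt_p (shift c2 f) 2 = 0"
  proof (rule ccontr)
    assume ne: "wt_p (shift c2 f) 2 \<noteq> 0"
    \<comment> \<open>A term u^i of weight 2 comes with p^(i+2), and i + 2 is at most 4; two double
      roots would require degree 4.\<close>
    have "degree (wt_p (shift c2 f) 2) \<le> 2"
      by (rule degree_le) (simp add: coeff_shift *)
    with w2_deg[OF _ ne] show False by simp
  qed
  with w2 have w2': "wt_p (shift c2 f) k = 0" if "k \<ge> 2" for k
    using that by (cases "k = 2") auto
  have d2': "[:- c2, 1:] ^ (j - 1) dvd coeff f j"
    using shift_low_coeffs_dvd[of 2 c2 f j] w2' by (simp add: numeral_2_eq_2)
  show "[:- c1, 1:] ^ (j - 1) * [:- c2, 1:] ^ (j - 1) dvd coeff f j"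
    by (rule linear_powers_dvd[OF c d1 d2'])
qed

text \<open>The divisor has degree 2k in u, so the total degree would be at least 5k, which is at
  least 15.\<close>

lemma wt_q_eq_0:
  fixes f :: "'a::field poly poly"
  assumes "total_bound f 10" "[:a, 1:] ^ k * [:b, 1:] ^ k dvd wt_q f k" "k \<ge> 3"
  shows "wt_q f k = 0"
proof (rule ccontr)
  assume ne: "wt_q f k \<noteq> 0"
  from dvd_imp_degree_le[OF assms(2) ne] degree_wt(2)[OF assms(1) ne] assms(3)
  show False by (simp add: degree_mult_eq degree_linear_power)
qed

lemma degree_coeff_le:
  fixes f :: "'a::comm_ring_1 poly poly"
  assumes "\<And>k. k \<ge> 3 \<Longrightarrow> wt_q f k = 0"
  shows "degree (coeff f j) \<le> j + 2"
proof (rule degree_le, intro allI impI)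
  fix i assume "j + 2 < i"
  then show "coeff (coeff f j) i = 0"
    using arg_cong[OF assms[of "i - j"], of "\<lambda>p. coeff p j"] by simp
qed

lemma degree_le_3_eq:
  fixes p :: "'a::zero poly"
  assumes "degree p \<le> 3"
  shows "p = [:coeff p 0, coeff p 1, coeff p 2, coeff p 3:]"
  using assms by (intro poly_eqI) (auto simp: coeff_pCons coeff_eq_0 numeral_eq_Suc split: nat.splits)

text \<open>Dividing the coefficient of p^j by (q^2 - q)^(j-1) leaves quotients of degree at most 2,
  3, 2, 1, 0 for j = 0, ..., 4. For j = 0 the truncated exponent is 0, which gives the bound
  2.\<close>

lemma coeff_normal_form:
  fixes f :: "'a::field poly poly"
  assumes "\<And>j. j \<ge> 5 \<Longrightarrow> coeff f j = 0" "\<And>j. [:0, - 1, 1:] ^ (j - 1) dvd coeff f j"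
    and "\<And>j. degree (coeff f j) \<le> j + 2"
  obtains e A B D E F f0 f1 f2 f3 g0 g1 g2 where
    "f = [:[:g0, g1, g2:], [:f0, f1, f2, f3:], [:0, - 1, 1:] * [:F, E, D:],
           [:0, - 1, 1:] ^ 2 * [:B, A:], [:0, - 1, 1:] ^ 3 * [:e:]:]"
proof -
  let ?M = "[:0, - 1, 1:] :: 'a poly"
  have "\<exists>s. coeff f j = ?M ^ (j - 1) * s \<and> degree s \<le> j + 2 - 2 * (j - 1)" if "j \<le> 4" for j
  proof -
    obtain s where s: "coeff f j = ?M ^ (j - 1) * s" using assms(2) by (auto elim: dvdE)
    have "degree s \<le> j + 2 - 2 * (j - 1)"
      by (rule degree_factor_le[of "?M ^ (j - 1)"])
        (use assms(3)[of j] that in \<open>simp_all add: s[symmetric] degree_power_eq del: One_nat_def\<close>)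
    with s show ?thesis by blast
  qed
  then obtain s where s: "coeff f j = ?M ^ (j - 1) * s j"
    and deg: "degree (s j) \<le> j + 2 - 2 * (j - 1)" if "j \<le> 4" for j
    by metis
  have cz: "coeff (s j) i = 0" if "j \<le> 4" "j + 2 - 2 * (j - 1) < i" for i j
    using deg[OF that(1)] that(2) by (simp add: coeff_eq_0)
  have s3: "s j = [:coeff (s j) 0, coeff (s j) 1, coeff (s j) 2, coeff (s j) 3:]" if "j \<le> 4" for j
    by (rule degree_le_3_eq) (use deg[OF that] that in linarith)
  have "f = [:coeff f 0, coeff f 1, coeff f 2, coeff f 3, coeff f 4:]"
    by (rule poly_eqI) (use assms(1) in \<open>auto simp: coeff_pCons numeral_eq_Suc split: nat.splits\<close>)
  also have "\<dots> = [:[:coeff (s 0) 0, coeff (s 0) 1, coeff (s 0) 2:],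
     [:coeff (s 1) 0, coeff (s 1) 1, coeff (s 1) 2, coeff (s 1) 3:],
     ?M * [:coeff (s 2) 0, coeff (s 2) 1, coeff (s 2) 2:],
     ?M ^ 2 * [:coeff (s 3) 0, coeff (s 3) 1:], ?M ^ 3 * [:coeff (s 4) 0:]:]"
  proof -
    have "s 0 = [:coeff (s 0) 0, coeff (s 0) 1, coeff (s 0) 2:]"
      using s3[of 0] cz[of 0 3] by simp
    moreover have "s 1 = [:coeff (s 1) 0, coeff (s 1) 1, coeff (s 1) 2, coeff (s 1) 3:]"
      using s3[of 1] by simp
    moreover have "s 2 = [:coeff (s 2) 0, coeff (s 2) 1, coeff (s 2) 2:]"
      using s3[of 2] cz[of 2 3] by simp
    moreover have "s 3 = [:coeff (s 3) 0, coeff (s 3) 1:]"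
      using s3[of 3] cz[of 3 2] cz[of 3 3] by simp
    moreover have "s 4 = [:coeff (s 4) 0:]"
      using s3[of 4] cz[of 4 1] cz[of 4 2] cz[of 4 3] by simp
    ultimately show ?thesis
      using s[of 0] s[of 1] s[of 2] s[of 3] s[of 4] by simp
  qed
  finally show ?thesis by (rule that)
qed

subsection \<open>The normal form\<close>

text \<open>Vieta's formulas by divided differences. If \<open>t\<close> is not a third distinct
  root, the formula for the sum of the roots has to be supplied instead.\<close>

lemma cubic_root_sums:
  fixes r s t x0 x1 x2 x3 :: "'a::field"
  assumes "r \<noteq> s" "poly [:x0, x1, x2, x3:] r = 0" "poly [:x0, x1, x2, x3:] s = 0"
    and "t \<noteq> r \<and> t \<noteq> s \<and> poly [:x0, x1, x2, x3:] t = 0 \<or> x2 = - (r + s + t) * x3"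
  shows "x2 = - (r + s + t) * x3 \<and> x1 = (r * s + r * t + s * t) * x3 \<and> x0 = - (r * s * t) * x3"
proof -
  have quad: "x1 + x2 * (r + y) + x3 * (r * r + r * y + y * y) = 0"
    if "r \<noteq> y" "poly [:x0, x1, x2, x3:] y = 0" for y
  proof -
    have "(r - y) * (x1 + x2 * (r + y) + x3 * (r * r + r * y + y * y)) = 0"
      using assms(2) that(2) by simp algebra
    with that(1) show ?thesis by simp
  qed
  note qs = quad[OF assms(1,3)]
  have x2: "x2 = - (r + s + t) * x3"
    using assms(4)
  proof
    assume t: "t \<noteq> r \<and> t \<noteq> s \<and> poly [:x0, x1, x2, x3:] t = 0"
    then have "x1 + x2 * (r + t) + x3 * (r * r + r * t + t * t) = 0"
      using quad[of t] by auto
    \<comment> \<open>The second divided difference isolates the sum of the roots.\<close>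
    with qs have "(s - t) * (x2 + x3 * (r + s + t)) = 0" by algebra
    with t have "x2 + x3 * (r + s + t) = 0" by auto
    then show ?thesis by algebra
  qed
  have x1: "x1 = (r * s + r * t + s * t) * x3" using qs x2 by algebra
  have "x0 = - (r * s * t) * x3" using assms(2) x1 x2 by simp algebra
  with x1 x2 show ?thesis by simp
qed

definition normal_form ::
  "'a::comm_ring_1 \<Rightarrow> 'a \<Rightarrow> 'a \<Rightarrow> 'a \<Rightarrow> 'a \<Rightarrow> 'a \<Rightarrow> 'a \<Rightarrow> 'a \<Rightarrow> 'a \<Rightarrow> 'a \<Rightarrow> 'a \<Rightarrow> 'a \<Rightarrow> 'a \<Rightarrow> 'a poly poly" where
  "normal_form e A B D E F f0 f1 f2 f3 g0 g1 g2 =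
    [:[:g0, g1, g2:], [:f0, f1, f2, f3:], [:0, - 1, 1:] * [:F, E, D:],
      [:0, - 1, 1:] ^ 2 * [:B, A:], [:0, - 1, 1:] ^ 3 * [:e:]:]"

lemma normal_form_expand:
  "normal_form e A B D E F f0 f1 f2 f3 g0 g1 g2 =
    [:[:g0, g1, g2:], [:f0, f1, f2, f3:], [:0, - F, F - E, E - D, D:],
      [:0, 0, B, A - 2 * B, B - 2 * A, A:], [:0, 0, 0, - e, 3 * e, - (3 * e), e:]:]"
  by (simp add: normal_form_def numeral_eq_Suc algebra_simps)

lemma nat_cases_7:
  "P 0 \<Longrightarrow> P 1 \<Longrightarrow> P 2 \<Longrightarrow> P 3 \<Longrightarrow> P 4 \<Longrightarrow> P 5 \<Longrightarrow> P 6 \<Longrightarrow> (\<And>n. P (n + 7)) \<Longrightarrow> P (n::nat)"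
proof -
  assume P: "P 0" "P 1" "P 2" "P 3" "P 4" "P 5" "P 6" "\<And>n. P (n + 7)"
  consider "n \<ge> 7" | "n \<in> {0, 1, 2, 3, 4, 5, 6}" by fastforce
  then show ?thesis
    using P(1-7) P(8)[of "n - 7"] by cases auto
qed

text \<open>These four polynomials carry all remaining conditions. The two cubics have leading
  coefficients of opposite sign because q^2 - q has slope -1 at q = 0 and slope 1 at q = 1.\<close>

lemma normal_form_wt:
  fixes e A B D E F f0 f1 f2 f3 g0 g1 g2 :: "'a::idom"
  defines "f \<equiv> normal_form e A B D E F f0 f1 f2 f3 g0 g1 g2"
  shows "wt_q f 2 = [:g2, f3, D, A, e:]"
    and "wt_q f 1 = [:g1, f2, E - D, B - 2 * A, - (3 * e):]"
    and "wt_p (shift 0 f) 1 = [:f0, - F, B, - e:]"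
    and "wt_p (shift 1 f) 1 = [:f0 + f1 + f2 + f3, D + E + F, A + B, e:]"
proof -
  show "wt_q f 2 = [:g2, f3, D, A, e:]"
    by (rule poly_eqI, rule nat_cases_7)
      (simp_all add: f_def normal_form_expand coeff_pCons numeral_eq_Suc)
  show "wt_q f 1 = [:g1, f2, E - D, B - 2 * A, - (3 * e):]"
    by (rule poly_eqI, rule nat_cases_7)
      (simp_all add: f_def normal_form_expand coeff_pCons numeral_eq_Suc)
  show "wt_p (shift 0 f) 1 = [:f0, - F, B, - e:]"
    by (rule poly_eqI, rule nat_cases_7)
      (simp_all add: f_def normal_form_expand coeff_shift pcompose_idR coeff_pCons numeral_eq_Suc)
  have "pcompose [:0, - 1, 1:] [:1, 1:] = [:0, 1, 1 :: 'a:]" by (simp add: pcompose_pCons)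
  then show "wt_p (shift 1 f) 1 = [:f0 + f1 + f2 + f3, D + E + F, A + B, e:]"
    by - (rule poly_eqI, rule nat_cases_7,
      simp_all add: f_def normal_form_def coeff_shift pcompose_mult pcompose_power pcompose_pCons
         coeff_pCons numeral_eq_Suc algebra_simps)
qed

lemma const_const_power: "[:[:x :: 'a::comm_ring_1:]:] ^ n = [:[:x ^ n:]:]"
  by (simp add: poly_const_pow)

lemma const_simps:
  "const (a + b) = const a + const b" "const (a - b) = const a - const b"
  "const (a * b) = const a * const b" "const (- a) = - const a" "const (a ^ n) = const a ^ n"
  "const (numeral m) = numeral m"
  by (simp_all add: const_eq_emb const_const_power numeral_poly)

text \<open>A quartic divided by a monic quartic leaves a constant, here \<open>y4\<close>. For the
  roots in use, \<open>a + b\<close> is \<kappa> and \<open>a * b\<close> is \<epsilon>, so the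
  factors are 2\<kappa>, \<delta>, 2\<kappa>\<epsilon> and the square of \<epsilon>.\<close>

lemma quadratic_sq_dvd:
  fixes a b :: "'a::field"
  assumes "[:a, 1:] ^ 2 * [:b, 1:] ^ 2 dvd [:y0, y1, y2, y3, y4:]"
  shows "y3 = 2 * (a + b) * y4" "y2 = ((a + b) ^ 2 + 2 * (a * b)) * y4"
    "y1 = 2 * (a + b) * (a * b) * y4" "y0 = (a * b) ^ 2 * y4"
proof -
  obtain s where s: "[:y0, y1, y2, y3, y4:] = [:a, 1:] ^ 2 * [:b, 1:] ^ 2 * s"
    using assms by (auto elim: dvdE)
  have "degree s \<le> 0"
    by (rule degree_factor_le[of "[:a, 1:] ^ 2 * [:b, 1:] ^ 2"])
      (simp_all add: s[symmetric] degree_mult_eq degree_linear_power)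
  then obtain c where "s = [:c:]" by (auto elim: degree_eq_zeroE)
  with s show "y3 = 2 * (a + b) * y4" "y2 = ((a + b) ^ 2 + 2 * (a * b)) * y4"
    "y1 = 2 * (a + b) * (a * b) * y4" "y0 = (a * b) ^ 2 * y4"
    by (simp_all add: power2_eq_square algebra_simps)
qed

text \<open>Long division by a monic quadratic with quotient coefficients \<open>y4\<close>,
  \<open>s1\<close>, \<open>s0\<close>; the vanishing remainder fixes the two lowest coefficients.
  This is the origin of the constants \<open>f2\<close> and \<open>b\<close> in
  \<open>I_ham\<close>.\<close>

lemma quadratic_dvd:
  fixes a b :: "'a::field"
  assumes "[:a, 1:] * [:b, 1:] dvd [:y0, y1, y2, y3, y4:]"
  defines "s1 \<equiv> y3 - (a + b) * y4"
  defines "s0 \<equiv> y2 - (a + b) * s1 - a * b * y4"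
  shows "y1 = (a + b) * s0 + a * b * s1" "y0 = a * b * s0"
proof -
  obtain s where s: "[:y0, y1, y2, y3, y4:] = [:a, 1:] * [:b, 1:] * s"
    using assms by (auto elim: dvdE)
  have "degree s \<le> 2"
    by (rule degree_factor_le[of "[:a, 1:] * [:b, 1:]"])
      (simp_all only: s[symmetric], simp_all)
  then have "s = [:coeff s 0, coeff s 1, coeff s 2:]"
    using degree_le_3_eq[of s] coeff_eq_0[of s 3] by simp
  then obtain c0 c1 c2 where "s = [:c0, c1, c2:]" by blast
  with s show "y1 = (a + b) * s0 + a * b * s1" "y0 = a * b * s0"
    by (simp_all add: s0_def s1_def algebra_simps)
qed

text \<open>\<open>q2\<close> determines \<open>A\<close>, \<open>D\<close>, \<open>f3\<close>,
  \<open>g2\<close>; the cubic conditions determine \<open>B\<close>, \<open>F\<close>,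
  \<open>f0\<close> and then \<open>E\<close>; \<open>q1\<close> gives \<open>f2\<close>,
  \<open>g1\<close>, and the last cubic condition gives \<open>f1\<close>. All are multiples of
  \<open>e\<close>, and only the additive \<open>g0\<close> stays free.\<close>

lemma normal_form_eq_I_ham:
  fixes \<alpha> :: "nat \<Rightarrow> complex"
  defines "\<beta>1 \<equiv> esym1 (\<alpha> 1) (\<alpha> 1 + \<alpha> 2) (\<alpha> 1 + \<alpha> 2 + \<alpha> 3)"
    and "\<beta>2 \<equiv> esym2 (\<alpha> 1) (\<alpha> 1 + \<alpha> 2) (\<alpha> 1 + \<alpha> 2 + \<alpha> 3)"
    and "\<beta>3 \<equiv> esym3 (\<alpha> 1) (\<alpha> 1 + \<alpha> 2) (\<alpha> 1 + \<alpha> 2 + \<alpha> 3)"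
    and "\<gamma>2 \<equiv> esym2 (\<alpha> 4) (\<alpha> 4 + \<alpha> 5) (\<alpha> 4 + \<alpha> 5 + \<alpha> 6)"
    and "\<gamma>3 \<equiv> esym3 (\<alpha> 4) (\<alpha> 4 + \<alpha> 5) (\<alpha> 4 + \<alpha> 5 + \<alpha> 6)"
  assumes f: "f = normal_form e A B D E F f0 f1 f2 f3 g0 g1 g2"
    and q2: "[:emb (\<alpha> 0), 1:] ^ 2 * [:emb (\<alpha> 0 + \<alpha> 7), 1:] ^ 2 dvd wt_q f 2"
    and q1: "[:emb (\<alpha> 0), 1:] * [:emb (\<alpha> 0 + \<alpha> 7), 1:] dvd wt_q f 1"
    and p0: "B = emb \<beta>1 * e" "F = emb \<beta>2 * e" "f0 = emb \<beta>3 * e"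
    and p1: "D + E + F = emb \<gamma>2 * e" "f0 + f1 + f2 + f3 = - (emb \<gamma>3 * e)"
  shows "f = smult [:e:] (I_ham \<alpha>) + [:[:g0:]:]"
proof -
  define \<kappa> \<epsilon> where "\<kappa> = 2 * \<alpha> 0 + \<alpha> 7" and "\<epsilon> = \<alpha> 0 * (\<alpha> 0 + \<alpha> 7)"
  define C :: "ct \<Rightarrow> ct poly poly" where "C x = [:[:x:]:]" for x
  have C: "C (x + y) = C x + C y" "C (x - y) = C x - C y" "C (x * y) = C x * C y"
    "C (- x) = - C x" "C (x ^ n) = C x ^ n" "C (numeral m) = numeral m" "C (emb z) = const z" for x y n m z
    by (simp_all add: C_def const_eq_emb numeral_poly const_const_power)
  have ke: "emb \<kappa> = emb (\<alpha> 0) + emb (\<alpha> 0 + \<alpha> 7)" "emb \<epsilon> = emb (\<alpha> 0) * emb (\<alpha> 0 + \<alpha> 7)"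
    by (simp_all add: \<kappa>_def \<epsilon>_def)
  note q2' = quadratic_sq_dvd[OF q2[unfolded f normal_form_wt], folded ke]
  note q1' = quadratic_dvd[OF q1[unfolded f normal_form_wt], folded ke]
  have f1: "f1 = - (emb \<gamma>3 * e) - f0 - f2 - f3" and E: "E = emb \<gamma>2 * e - D - F"
    using p1 by algebra+
  let ?q = var_q and ?p = var_p
  have "f = C e * (?q * (?q - 1)) ^ 3 * ?p ^ 4 + (C B + C A * ?q) * (?q * (?q - 1)) ^ 2 * ?p ^ 3
      + (C F + C E * ?q + C D * ?q ^ 2) * (?q * (?q - 1)) * ?p ^ 2
      + (C f0 + C f1 * ?q + C f2 * ?q ^ 2 + C f3 * ?q ^ 3) * ?p
      + (C g0 + C g1 * ?q + C g2 * ?q ^ 2)"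
    unfolding f normal_form_def C_def var_q_def var_p_def
    by (simp add: numeral_eq_Suc one_pCons)
  also have "\<dots> = C e * I_ham \<alpha> + C g0"
    unfolding I_ham_def Let_def \<kappa>_def[symmetric] \<epsilon>_def[symmetric] \<beta>1_def[symmetric]
      \<beta>2_def[symmetric] \<beta>3_def[symmetric] \<gamma>2_def[symmetric] \<gamma>3_def[symmetric]
      q1' f1 E p0 q2' C const_simps
    by algebra
  also have "\<dots> = smult [:e:] (I_ham \<alpha>) + [:[:g0:]:]"
    by (simp add: C_def)
  finally show ?thesis .
qed

section \<open>Coinciding charts and the final assembly\<close>

lemma card_3_3_ge_5:
  assumes "card {a1, a2, a3} + card {c1, c2, c3} \<ge> 5"
  shows "distinct [a1, a2, a3] \<and> (c1 \<noteq> c2 \<or> c1 \<noteq> c3 \<or> c2 \<noteq> c3) \<or>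
         distinct [c1, c2, c3] \<and> (a1 \<noteq> a2 \<or> a1 \<noteq> a3 \<or> a2 \<noteq> a3)"
  using assms by (auto simp: card_insert_if split: if_splits)

text \<open>Any distinct pair may serve as the two known roots of \<open>cubic_root_sums\<close>, as
  the conclusion is symmetric.\<close>

lemma esym_root_sums:
  fixes r s t :: complex and x0 x1 x2 x3 :: ct
  defines "f \<equiv> [:x0, x1, x2, x3:]"
  assumes roots: "poly f (emb r) = 0" "poly f (emb s) = 0" "poly f (emb t) = 0"
    and ne: "r \<noteq> s \<or> r \<noteq> t \<or> s \<noteq> t"
    and x2: "distinct [r, s, t] \<or> x2 = - (emb (esym1 r s t) * x3)"
  shows "x2 = - (emb (esym1 r s t) * x3)"
    and "x1 = emb (esym2 r s t) * x3"
    and "x0 = - (emb (esym3 r s t) * x3)"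
proof -
  have "x2 = - (emb (esym1 r s t) * x3) \<and> x1 = emb (esym2 r s t) * x3 \<and> x0 = - (emb (esym3 r s t) * x3)"
    using ne
  proof (elim disjE)
    assume "r \<noteq> s"
    with cubic_root_sums[of "emb r" "emb s" x0 x1 x2 x3 "emb t"] roots x2 show ?thesis
      by (simp add: f_def esym1_def esym2_def esym3_def algebra_simps, blast)
  next
    assume "r \<noteq> t"
    with cubic_root_sums[of "emb r" "emb t" x0 x1 x2 x3 "emb s"] roots x2 show ?thesis
      by (simp add: f_def esym1_def esym2_def esym3_def algebra_simps, blast)
  next
    assume "s \<noteq> t"
    with cubic_root_sums[of "emb s" "emb t" x0 x1 x2 x3 "emb r"] roots x2 show ?thesis
      by (simp add: f_def esym1_def esym2_def esym3_def algebra_simps)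
  qed
  then show "x2 = - (emb (esym1 r s t) * x3)" "x1 = emb (esym2 r s t) * x3"
    "x0 = - (emb (esym3 r s t) * x3)"
    by blast+
qed

text \<open>Multiplying \<open>H\<close> by a nonzero element of \<open>ct\<close> preserves all
  assumptions on it, hence the comparison up to the coefficient of q^6 p^4.
  \<open>nondegenerate\<close> provides three distinct parameters at one of the points q = 0, 1 and
  at least two at the other.\<close>

theorem theorem7p1:
  fixes H :: "ct poly poly" and \<alpha> :: "nat \<Rightarrow> complex"
  assumes relation: "4 * \<alpha> 0 + 3 * \<alpha> 1 + 2 * \<alpha> 2 + \<alpha> 3 + 3 * \<alpha> 4 + 2 * \<alpha> 5 + \<alpha> 6 + 2 * \<alpha> 7 = 0"
    and nondegenerate: "card (r_charts \<alpha> ` {1..6}) \<ge> 5"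
    and A1: "total_degree H = 10"
    and A2: "\<forall>i\<le>6. poly_hamiltonian_in H (r_charts \<alpha> i)"
    and A3: "\<exists>K\<^sub>0. has_hamiltonian_in H (r_charts \<alpha> 0) K\<^sub>0 \<and> poly_hamiltonian_in K\<^sub>0 (r7_chart \<alpha>)"
  shows "coeff (coeff H 4) 6 \<noteq> 0 \<and>
         ham_system H = ham_system (smult [:coeff (coeff H 4) 6:] (I_ham \<alpha>))"
proof -
  define a where "a = (\<lambda>i::nat. if i = 1 then \<alpha> 1 else if i = 2 then \<alpha> 1 + \<alpha> 2 else \<alpha> 1 + \<alpha> 2 + \<alpha> 3)"
  define c where "c = (\<lambda>i::nat. if i = 1 then \<alpha> 4 else if i = 2 then \<alpha> 4 + \<alpha> 5 else \<alpha> 4 + \<alpha> 5 + \<alpha> 6)"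
  have a: "a 1 = \<alpha> 1" "a 2 = \<alpha> 1 + \<alpha> 2" "a 3 = \<alpha> 1 + \<alpha> 2 + \<alpha> 3"
    and c: "c 1 = \<alpha> 4" "c 2 = \<alpha> 4 + \<alpha> 5" "c 3 = \<alpha> 4 + \<alpha> 5 + \<alpha> 6"
    by (simp_all add: a_def c_def)
  have charts: "r_charts \<alpha> 0 = chart_inf (\<alpha> 0)"
    "r_charts \<alpha> 1 = chart_at 0 (a 1)" "r_charts \<alpha> 2 = chart_at 0 (a 2)" "r_charts \<alpha> 3 = chart_at 0 (a 3)"
    "r_charts \<alpha> 4 = chart_at 1 (c 1)" "r_charts \<alpha> 5 = chart_at 1 (c 2)" "r_charts \<alpha> 6 = chart_at 1 (c 3)"
    unfolding a c by (simp_all add: r_charts_def)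
  have "{1..6} = {1, 2, 3, 4, 5, 6 :: nat}" by auto
  then have "r_charts \<alpha> ` {1..6} = chart_at 0 ` {a 1, a 2, a 3} \<union> chart_at 1 ` {c 1, c 2, c 3}"
    by (simp only: image_insert image_empty charts Un_insert_left Un_empty_left)
  then have "5 \<le> card (chart_at 0 ` {a 1, a 2, a 3}) + card (chart_at 1 ` {c 1, c 2, c 3})"
    using nondegenerate card_Un_le[of "chart_at 0 ` {a 1, a 2, a 3}" "chart_at 1 ` {c 1, c 2, c 3}"]
    by simp
  \<comment> \<open>A chart is determined by its parameter, so distinct charts have distinct
    parameters.\<close>
  also have "\<dots> \<le> card {a 1, a 2, a 3} + card {c 1, c 2, c 3}"
    by (intro add_mono card_image_le) simp_all
  finally have cases: "distinct [a 1, a 2, a 3] \<and> (c 1 \<noteq> c 2 \<or> c 1 \<noteq> c 3 \<or> c 2 \<noteq> c 3) \<or>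
         distinct [c 1, c 2, c 3] \<and> (a 1 \<noteq> a 2 \<or> a 1 \<noteq> a 3 \<or> a 2 \<noteq> a 3)"
    by (rule card_3_3_ge_5)

  have "poly_hamiltonian_in H (chart_at 0 (a i))" "poly_hamiltonian_in H (chart_at 1 (c i))"
    if "i \<in> {1, 2, 3}" for i
    using A2[rule_format, of 1] A2[rule_format, of 2] A2[rule_format, of 3]
      A2[rule_format, of 4] A2[rule_format, of 5] A2[rule_format, of 6] that
    by (auto simp: charts simp del: One_nat_def)
  note chart_at_weight[OF this(1)] chart_at_weight[OF this(2)]
  then have w: "[:- emb (a i), 1:] ^ k dvd wt_p (shift 0 H) k" "[:- emb (c i), 1:] ^ k dvd wt_p (shift 1 H) k"
    if "i \<in> {1, 2, 3}" "k \<ge> 1" for i k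
    using that by simp_all
  have wq: "[:emb (\<alpha> 0), 1:] ^ k * [:emb (\<alpha> 0 + \<alpha> 7), 1:] ^ k dvd wt_q H k" if "k \<ge> 1" for k
    using A3 chart_inf_weight[OF _ _ that] by (auto simp: charts r7_chart_def)

  have tb: "total_bound H 10" using total_bound_total_degree[of H] A1 by simp
  \<comment> \<open>\<open>cases\<close> decides which of q = 0 and q = 1 plays the role of the
    point with three distinct roots.\<close>
  have sb: "(j \<ge> 5 \<longrightarrow> coeff H j = 0) \<and> [:0, - 1, 1:] ^ (j - 1) dvd coeff H j" for j
  proof -
    have M: "[:0, - 1, 1 :: ct:] ^ n = [:- 0, 1:] ^ n * [:- 1, 1:] ^ n" for n
      by (simp flip: power_mult_distrib)
    from cases show ?thesis
    proof
      assume "distinct [a 1, a 2, a 3] \<and> (c 1 \<noteq> c 2 \<or> c 1 \<noteq> c 3 \<or> c 2 \<noteq> c 3)"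
      moreover from this obtain i i' where "{i, i'} \<subseteq> {1, 2, 3}" "c i \<noteq> c i'" by blast
      ultimately show ?thesis
        unfolding M using w
        by (intro conjI impI support_bound[OF tb, of 0 1 "emb (a 1)" "emb (a 2)" "emb (a 3)" "emb (c i)" "emb (c i')"])
          auto
    next
      assume "distinct [c 1, c 2, c 3] \<and> (a 1 \<noteq> a 2 \<or> a 1 \<noteq> a 3 \<or> a 2 \<noteq> a 3)"
      moreover from this obtain i i' where "{i, i'} \<subseteq> {1, 2, 3}" "a i \<noteq> a i'" by blast
      ultimately show ?thesis
        unfolding M mult.commute[of "[:- 0, 1:] ^ _"] using w
        by (intro conjI impI support_bound[OF tb, of 1 0 "emb (c 1)" "emb (c 2)" "emb (c 3)" "emb (a i)" "emb (a i')"])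
          auto
    qed
  qed
  have deg: "degree (coeff H j) \<le> j + 2" for j
    by (rule degree_coeff_le, rule wt_q_eq_0[OF tb wq]) auto
  obtain e A B D E F f0 f1 f2 f3 g0 g1 g2
    where nf: "H = normal_form e A B D E F f0 f1 f2 f3 g0 g1 g2"
    unfolding normal_form_def by (rule coeff_normal_form[of H]) (use sb deg in auto)

  let ?\<beta>1 = "esym1 (a 1) (a 2) (a 3)" and ?\<gamma>1 = "esym1 (c 1) (c 2) (c 3)"
  have roots: "poly [:f0, - F, B, - e:] (emb (a i)) = 0"
    "poly [:f0 + f1 + f2 + f3, D + E + F, A + B, e:] (emb (c i)) = 0" if "i \<in> {1, 2, 3}" for i
    using w[OF that, of 1] unfolding nf normal_form_wt
    by (simp_all only: power_one_right poly_eq_0_iff_dvd[symmetric] order_refl)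
  have "A = 2 * (emb (\<alpha> 0) + emb (\<alpha> 0 + \<alpha> 7)) * e"
    using wq[of 2] unfolding nf normal_form_wt by (intro quadratic_sq_dvd(1)) simp
  \<comment> \<open>The relation between the parameters says that 2\<kappa> plus the two root sums
    is zero.\<close>
  moreover have "2 * (emb (\<alpha> 0) + emb (\<alpha> 0 + \<alpha> 7)) + emb ?\<beta>1 + emb ?\<gamma>1 = 0"
  proof -
    have "2 * (\<alpha> 0 + (\<alpha> 0 + \<alpha> 7)) + ?\<beta>1 + ?\<gamma>1 = 0"
      using relation unfolding esym1_def a c by (simp add: algebra_simps)
    from arg_cong[OF this, of emb] show ?thesis by simp
  qed
  ultimately have AB: "A + emb ?\<beta>1 * e + emb ?\<gamma>1 * e = 0" by algebra
  \<comment> \<open>The relation between the parameters replaces the missing third root when two roots coincide.\<close>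
  have B: "B = emb ?\<beta>1 * e \<and> A + B = - (emb ?\<gamma>1 * e)"
    using cases
  proof
    assume "distinct [a 1, a 2, a 3] \<and> (c 1 \<noteq> c 2 \<or> c 1 \<noteq> c 3 \<or> c 2 \<noteq> c 3)"
    then have "B = - (emb ?\<beta>1 * - e)"
      by (intro esym_root_sums(1)[OF roots(1)[of 1] roots(1)[of 2] roots(1)[of 3]]) auto
    with AB show ?thesis by algebra
  next
    assume "distinct [c 1, c 2, c 3] \<and> (a 1 \<noteq> a 2 \<or> a 1 \<noteq> a 3 \<or> a 2 \<noteq> a 3)"
    then have "A + B = - (emb ?\<gamma>1 * e)"
      by (intro esym_root_sums(1)[OF roots(2)[of 1] roots(2)[of 2] roots(2)[of 3]]) auto
    with AB show ?thesis by algebra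
  qed
  have ne: "a 1 \<noteq> a 2 \<or> a 1 \<noteq> a 3 \<or> a 2 \<noteq> a 3" "c 1 \<noteq> c 2 \<or> c 1 \<noteq> c 3 \<or> c 2 \<noteq> c 3"
    using cases by auto
  have p0: "- F = emb (esym2 (a 1) (a 2) (a 3)) * - e" "f0 = - (emb (esym3 (a 1) (a 2) (a 3)) * - e)"
    by (rule esym_root_sums(2,3)[OF roots(1)[of 1] roots(1)[of 2] roots(1)[of 3]];
        use ne B in simp)+
  have p1: "D + E + F = emb (esym2 (c 1) (c 2) (c 3)) * e"
    "f0 + f1 + f2 + f3 = - (emb (esym3 (c 1) (c 2) (c 3)) * e)"
    by (rule esym_root_sums(2,3)[OF roots(2)[of 1] roots(2)[of 2] roots(2)[of 3]];
        use ne B in blast)+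
  have H: "H = smult [:e:] (I_ham \<alpha>) + [:[:g0:]:]"
    using wq[of 2] wq[of 1] p0 p1 B
    by (intro normal_form_eq_I_ham[OF nf]) (simp_all add: a c del: One_nat_def)
  \<comment> \<open>Otherwise \<open>H\<close> would be the constant \<open>g0\<close>, of total
    degree 0 instead of 10.\<close>
  have "e \<noteq> 0"
  proof
    assume "e = 0"
    then have "coeff (coeff H j) i = (if i = 0 \<and> j = 0 then g0 else 0)" for i j
      by (cases i; cases j) (simp_all add: H)
    then have "{i + j |i j. coeff (coeff H j) i \<noteq> 0} \<subseteq> {0}" by auto
    then have "insert 0 {i + j |i j. coeff (coeff H j) i \<noteq> 0} = {0}" by blast
    with A1 show False by (simp add: total_degree_def)
  qed
  moreover have "coeff (coeff H 4) 6 = e"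
    by (simp add: nf normal_form_expand numeral_eq_Suc)
  \<comment> \<open>The additive \<open>g0\<close> depends on t only and disappears from both
    partial derivatives.\<close>
  moreover have "ham_system H = ham_system (smult [:e:] (I_ham \<alpha>))"
    by (simp add: H ham_system_def pd_linear pderiv_add map_poly_pCons)
  ultimately show ?thesis by simp
qed

end
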